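(* Consider either case (a), a lattice system $X$ together with a family $F=\{f_g\in C(X): g\in G\}$ satisfying $\Delta_\Lambda(F)<\infty$ for all $\Lambda\in\mathcal P_f(G)$, or case (b), a dynamical system $(G,X)$ together with a function $f\in\mathbb B(X)$ (all notions as defined in the context). Then a Borel probability measure $\mu$ on $X$ is a Gibbs measure (for $F$, respectively $f$) if and only if it is a Gibbs conformal measure (for $F$, respectively $f$).
   Context: $G$ is a countably infinite discrete set, $\mathcal P_f(G)$ is the set of finite subsets of $G$, and $\Lambda^c=G\setminus\Lambda$. $C(X)$ is the set of real-valued continuous functions on $X$. Two cases are considered. Case (a), lattice system: for each $g\in G$, $A_g$ is a finite set with the discrete distance $d$ (values $0,1$), and $X$ is a closed subset of the product space $\prod_{g\in G}A_g$; elements are $x=(x(g))_{g\in G}$. No group structure on $G$ is assumed. For $\Lambda\subset G$, $d_\Lambda(x,y):=\sup\{d(x(g),y(g)):g\in\Lambda\}$. Case (b), dynamical system $(G,X)$: $G$ is a group, $(X,d)$ is a compact ultrametric space, and $G$ acts on $X$ by homeomorphisms $x\mapsto g\cdot x$. The action is expansive: there is a constant $0<c<1$ (expansive constant) such that $x\neq y$ implies $d(g\cdot x,g\cdot y)>c$ for some $g\in G$. For $\Lambda\subset G$, $d_\Lambda(x,y):=\sup\{d(g\cdot x,g\cdot y):g\in\Lambda\}$. (A supremum over the empty set is $0$.) A constant $\varepsilon^*$ is fixed with $0<\varepsilon^*\le c$ (in case (a), any fixed $0<\varepsilon^*<1$). Set $$[u]_\Lambda:=\{y\in X: d_\Lambda(u,y)\le\varepsilon^*\},\qquad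 W_\Lambda^x:=\{y\in X: d_{\Lambda^c}(x,y)\le\varepsilon^*\}.$$ For finite $\Lambda$ the sets $W_\Lambda^x$ are finite and $|[v]_\Lambda\cap W_\Lambda^x|\le1$. Case (b): $\mathbb B(X)$ is the set of $f\in C(X)$ such that for every $\Lambda\in\mathcal P_f(G)$ $$\Delta_\Lambda(f):=\sup\Big\{\sum_{g\notin\Lambda}|f(g\cdot x)-f(g\cdot y)|: x,y\in X,\ d_{\Lambda^c}(x,y)\le\varepsilon^*\Big\}<\infty.$$ Case (a): $\Delta_\Lambda(F):=\sup\{\sum_{g\notin\Lambda}|f_g(x)-f_g(y)|: x,y\in X,\ x(g)=y(g)\ \forall g\in\Lambda^c\}$. For $x\in X$ and $y\in\bigcup_{\Lambda\in\mathcal P_f(G)}W_\Lambda^x$ define the absolutely convergent sum $$\psi_f(x,y):=\sum_{g\in G}\big(f(g\cdot y)-f(g\cdot x)\big)\ \text{(case (b))},\qquad \psi_F(x,y):=\sum_{g\in G}\big(f_g(y)-f_g(x)\big)\ \text{(case (a))}.$$ Write $\psi$ for $\psi_f$ or $\psi_F$. Gibbs measure: for $\Lambda\in\mathcal P_f(G)$ and $y\in W_\Lambda^x$ put $\pi_\Lambda(y|x):=e^{\psi(x,y)}/\sum_{y'\in W_\Lambda^x}e^{\psi(x,y')}$, and for bounded $\varphi:X\to\mathbb R$ put $M_\Lambda(\varphi)(x):=\sum_{y\in W_\Lambda^x}\varphi(y)\pi_\Lambda(y|x)$. A Borel probability measure $\mu$ on $X$ is a Gibbs measure if $\int\varphi\,d\mu=\int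 M_\Lambda(\varphi)\,d\mu$ for all $\Lambda\in\mathcal P_f(G)$ and all $\varphi\in C(X)$. Gibbs conformal measure: for $\Lambda\in\mathcal P_f(G)$ and $u,v\in X$ define $\phi_\Lambda^{u,v}:X\to X$ by $\phi_\Lambda^{u,v}(x)=y$ if $x\in[u]_\Lambda$ and $y\in[v]_\Lambda\cap W_\Lambda^x$; $\phi_\Lambda^{u,v}(x)=z$ if $x\in[v]_\Lambda$ and $z\in[u]_\Lambda\cap W_\Lambda^x$; $\phi_\Lambda^{u,v}(x)=x$ otherwise. These maps are Borel measurable involutions. A Borel probability measure $\mu$ on $X$ is a Gibbs conformal measure if for every $\phi=\phi_\Lambda^{u,v}$ one has $\frac{d\mu\circ\phi}{d\mu}(x)=\exp\psi(x,\phi(x))$ $\mu$-a.s., i.e. $\mu(\phi(A))=\int_A e^{\psi(x,\phi(x))}\,d\mu(x)$ for all Borel sets $A\subset X$. *)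

theory Defs
  imports "HOL-Probability.Probability" "HOL-Algebra.Group_Action"
begin

definition borel_on :: "'x topology \<Rightarrow> 'x measure" where
  "borel_on T = sigma (topspace T) {U. openin T U}"

definition borel_prob_measure :: "'x topology \<Rightarrow> 'x measure \<Rightarrow> bool" where
  "borel_prob_measure T \<mu> \<longleftrightarrow> prob_space \<mu> \<and> sets \<mu> = sets (borel_on T)"

text \<open>
  The two cases share all definitions once the following data are given: the topological space
  \<open>T\<close> carried by \<open>X\<close>; the local distances \<open>D g x y\<close>, which are \<open>d (x g) (y g)\<close> for a lattice
  system and \<open>d (g \<cdot> x) (g \<cdot> y)\<close> for a dynamical system; the constant \<open>\<epsilon>\<close> (the constant
  epsilon-star of the theory); and the family \<open>F\<close> of local functions, which for a dynamical
  system is \<open>F g x = f (g \<cdot> x)\<close>. This locale has no assumptions and only fixes these data.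
\<close>

locale gibbs_setting =
  fixes G :: "'g set" and T :: "'x topology"
    and D :: "'g \<Rightarrow> 'x \<Rightarrow> 'x \<Rightarrow> real" and \<epsilon> :: real
    and F :: "'g \<Rightarrow> 'x \<Rightarrow> real"
begin

definition dist_on :: "'g set \<Rightarrow> 'x \<Rightarrow> 'x \<Rightarrow> real" where
  "dist_on \<Lambda> x y = (if \<Lambda> = {} then 0 else (SUP g\<in>\<Lambda>. D g x y))"

text \<open>\<open>cyl \<Lambda> u\<close> is the set written $[u]_\Lambda$.\<close>

definition cyl :: "'g set \<Rightarrow> 'x \<Rightarrow> 'x set" where
  "cyl \<Lambda> u = {y \<in> topspace T. dist_on \<Lambda> u y \<le> \<epsilon>}"

definition W :: "'g set \<Rightarrow> 'x \<Rightarrow> 'x set" where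
  "W \<Lambda> x = {y \<in> topspace T. dist_on (G - \<Lambda>) x y \<le> \<epsilon>}"

definition psi :: "'x \<Rightarrow> 'x \<Rightarrow> real" where
  "psi x y = (\<Sum>\<^sub>\<infinity>g\<in>G. F g y - F g x)"

text \<open>\<open>kern \<Lambda> x y\<close> is $\pi_\Lambda(y|x)$.\<close>

definition kern :: "'g set \<Rightarrow> 'x \<Rightarrow> 'x \<Rightarrow> real" where
  "kern \<Lambda> x y = exp (psi x y) / (\<Sum>y'\<in>W \<Lambda> x. exp (psi x y'))"

definition M :: "'g set \<Rightarrow> ('x \<Rightarrow> real) \<Rightarrow> 'x \<Rightarrow> real" where
  "M \<Lambda> \<phi> x = (\<Sum>y\<in>W \<Lambda> x. \<phi> y * kern \<Lambda> x y)"

definition gibbs_measure :: "'x measure \<Rightarrow> bool" where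
  "gibbs_measure \<mu> \<longleftrightarrow>
     (\<forall>\<Lambda> \<phi>. finite \<Lambda> \<and> \<Lambda> \<subseteq> G \<and> continuous_map T euclideanreal \<phi> \<longrightarrow>
        integral\<^sup>L \<mu> \<phi> = integral\<^sup>L \<mu> (M \<Lambda> \<phi>))"

text \<open>
  The sets \<open>cyl \<Lambda> v \<inter> W \<Lambda> x\<close> have at most one element, so \<open>THE\<close> picks that element. A point
  lying in both cylinders is fixed by either branch, as the cylinders then coincide.
\<close>

definition swap :: "'g set \<Rightarrow> 'x \<Rightarrow> 'x \<Rightarrow> 'x \<Rightarrow> 'x" where
  "swap \<Lambda> u v x =
     (if x \<in> cyl \<Lambda> u \<and> cyl \<Lambda> v \<inter> W \<Lambda> x \<noteq> {} then (THE y. y \<in> cyl \<Lambda> v \<inter> W \<Lambda> x)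
      else if x \<in> cyl \<Lambda> v \<and> cyl \<Lambda> u \<inter> W \<Lambda> x \<noteq> {} then (THE z. z \<in> cyl \<Lambda> u \<inter> W \<Lambda> x)
      else x)"

definition gibbs_conformal_measure :: "'x measure \<Rightarrow> bool" where
  "gibbs_conformal_measure \<mu> \<longleftrightarrow>
     (\<forall>\<Lambda> u v. finite \<Lambda> \<and> \<Lambda> \<subseteq> G \<and> u \<in> topspace T \<and> v \<in> topspace T \<longrightarrow>
        (\<forall>B\<in>sets (borel_on T).
           emeasure \<mu> (swap \<Lambda> u v ` B) =
             (\<integral>\<^sup>+x\<in>B. ennreal (exp (psi x (swap \<Lambda> u v x))) \<partial>\<mu>)))"

end

definition lattice_topology :: "'g set \<Rightarrow> ('g \<Rightarrow> 'a set) \<Rightarrow> ('g \<Rightarrow> 'a) set \<Rightarrow> ('g \<Rightarrow> 'a) topology" where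
  "lattice_topology G A X =
     subtopology (product_topology (\<lambda>g. discrete_topology (A g)) G) X"

definition lattice_dist :: "'g \<Rightarrow> ('g \<Rightarrow> 'a) \<Rightarrow> ('g \<Rightarrow> 'a) \<Rightarrow> real" where
  "lattice_dist g x y = (if x g = y g then 0 else 1)"

locale lattice_system =
  fixes G :: "'g set" and A :: "'g \<Rightarrow> 'a set" and X :: "('g \<Rightarrow> 'a) set"
  assumes countable_sites: "countable G"
    and infinite_sites: "infinite G"
    and finite_alphabets: "\<And>g. g \<in> G \<Longrightarrow> finite (A g)"
    and closed_X: "closedin (product_topology (\<lambda>g. discrete_topology (A g)) G) X"

definition lattice_Delta ::
    "'g set \<Rightarrow> ('g \<Rightarrow> 'a) set \<Rightarrow> ('g \<Rightarrow> ('g \<Rightarrow> 'a) \<Rightarrow> real) \<Rightarrow> 'g set \<Rightarrow> ennreal" where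
  "lattice_Delta G X F \<Lambda> =
     (SUP (x, y)\<in>{(x, y). x \<in> X \<and> y \<in> X \<and> (\<forall>g\<in>G - \<Lambda>. x g = y g)}.
        \<Sum>\<^sub>\<infinity>g\<in>G - \<Lambda>. ennreal \<bar>F g x - F g y\<bar>)"

definition lattice_potential ::
    "'g set \<Rightarrow> ('g \<Rightarrow> 'a set) \<Rightarrow> ('g \<Rightarrow> 'a) set \<Rightarrow> ('g \<Rightarrow> ('g \<Rightarrow> 'a) \<Rightarrow> real) \<Rightarrow> bool" where
  "lattice_potential G A X F \<longleftrightarrow>
     (\<forall>g\<in>G. continuous_map (lattice_topology G A X) euclideanreal (F g)) \<and>
     (\<forall>\<Lambda>. finite \<Lambda> \<and> \<Lambda> \<subseteq> G \<longrightarrow> lattice_Delta G X F \<Lambda> < \<infinity>)"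

locale expansive_system =
  action: group_action \<Gamma> X act + metric: Metric_space X d
  for \<Gamma> :: "('g, 'm) monoid_scheme" and X :: "'x set"
    and act :: "'g \<Rightarrow> 'x \<Rightarrow> 'x" and d :: "'x \<Rightarrow> 'x \<Rightarrow> real" +
  fixes c :: real
  assumes countable_group: "countable (carrier \<Gamma>)"
    and infinite_group: "infinite (carrier \<Gamma>)"
    and compact_X: "compact_space metric.mtopology"
    and ultrametric: "\<And>x y z. \<lbrakk>x \<in> X; y \<in> X; z \<in> X\<rbrakk> \<Longrightarrow> d x z \<le> max (d x y) (d y z)"
    and homeomorphic: "\<And>g. g \<in> carrier \<Gamma> \<Longrightarrow>
          homeomorphic_map metric.mtopology metric.mtopology (act g)"
    and c_pos: "0 < c" and c_less_1: "c < 1"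
    and expansive: "\<And>x y. \<lbrakk>x \<in> X; y \<in> X; x \<noteq> y\<rbrakk> \<Longrightarrow>
          \<exists>g\<in>carrier \<Gamma>. d (act g x) (act g y) > c"

definition action_dist ::
    "('g \<Rightarrow> 'x \<Rightarrow> 'x) \<Rightarrow> ('x \<Rightarrow> 'x \<Rightarrow> real) \<Rightarrow> 'g \<Rightarrow> 'x \<Rightarrow> 'x \<Rightarrow> real" where
  "action_dist act d g x y = d (act g x) (act g y)"

definition action_Delta ::
    "'g set \<Rightarrow> 'x set \<Rightarrow> ('g \<Rightarrow> 'x \<Rightarrow> 'x) \<Rightarrow> ('x \<Rightarrow> 'x \<Rightarrow> real) \<Rightarrow> real \<Rightarrow> ('x \<Rightarrow> real) \<Rightarrow>
      'g set \<Rightarrow> ennreal" where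
  "action_Delta G X act d \<epsilon> f \<Lambda> =
     (SUP (x, y)\<in>{(x, y). x \<in> X \<and> y \<in> X \<and>
                     gibbs_setting.dist_on (action_dist act d) (G - \<Lambda>) x y \<le> \<epsilon>}.
        \<Sum>\<^sub>\<infinity>g\<in>G - \<Lambda>. ennreal \<bar>f (act g x) - f (act g y)\<bar>)"

text \<open>\<open>action_B\<close> is the space written $\mathbb B(X)$.\<close>

definition action_B ::
    "'g set \<Rightarrow> 'x set \<Rightarrow> ('g \<Rightarrow> 'x \<Rightarrow> 'x) \<Rightarrow> ('x \<Rightarrow> 'x \<Rightarrow> real) \<Rightarrow> real \<Rightarrow> ('x \<Rightarrow> real) set" where
  "action_B G X act d \<epsilon> =
     {f. continuous_map (Metric_space.mtopology X d) euclideanreal f \<and>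
         (\<forall>\<Lambda>. finite \<Lambda> \<and> \<Lambda> \<subseteq> G \<longrightarrow> action_Delta G X act d \<epsilon> f \<Lambda> < \<infinity>)}"

end

theory Submission
  imports Defs
begin

text \<open>
  Both cases are instances of one setting: a compact space with countably many equivalence
  relations \<open>D g x y \<le> \<epsilon>\<close> whose classes are clopen and which together separate points. For finite
  \<open>\<Lambda>\<close> there are finitely many cylinders \<open>cyl \<Lambda> u\<close>, and each meets \<open>W \<Lambda> x\<close> in at most one point, so
  every sum over \<open>W \<Lambda> x\<close> is a finite sum, over pairs of cylinders, of terms evaluated at
  \<open>swap \<Lambda> u v x\<close>. Both notions are equivalent to the intermediate property \<open>dlr_measure\<close>, which is
  the Gibbs property tested on all nonnegative Borel functions. A Gibbs measure has it because
  clopen sets have continuous indicators and generate the Borel sets. Given it, the substitution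
  \<open>y \<mapsto> swap \<Lambda> u v y\<close> inside \<open>W \<Lambda> x\<close> and the cocycle identity for \<open>psi\<close> yield conformality;
  conversely, conformality gives a mass transport principle, and transporting \<open>h x * kern \<Lambda> x y\<close>
  yields the property by detailed balance.
\<close>

section \<open>Cylinders and the Borel sets\<close>

text \<open>Transitivity at the single level \<epsilon> takes the place of a triangle inequality. In
  the dynamical case it comes from ultrametricity and \<open>separating\<close> from expansiveness.
  \<open>summable_F\<close> is what finiteness of the variations provides, and \<open>bdd_D\<close>
  makes the real supremum in \<open>dist_on\<close> genuine.\<close>

locale gibbs_system = gibbs_setting G T D \<epsilon> F
  for G :: "'g set" and T :: "'x topology" and D :: "'g \<Rightarrow> 'x \<Rightarrow> 'x \<Rightarrow> real"
    and \<epsilon> :: real and F :: "'g \<Rightarrow> 'x \<Rightarrow> real" +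
  assumes countable_G: "countable G"
    and infinite_G: "infinite G"
    and compact_T: "compact_space T"
    and eps_nonneg: "0 \<le> \<epsilon>"
    and bdd_D: "\<And>x y. x \<in> topspace T \<Longrightarrow> y \<in> topspace T \<Longrightarrow> bdd_above ((\<lambda>g. D g x y) ` G)"
    and D_refl: "\<And>g x. g \<in> G \<Longrightarrow> x \<in> topspace T \<Longrightarrow> D g x x \<le> \<epsilon>"
    and D_sym: "\<And>g x y. g \<in> G \<Longrightarrow> x \<in> topspace T \<Longrightarrow> y \<in> topspace T \<Longrightarrow> D g x y = D g y x"
    and D_trans: "\<And>g x y z. \<lbrakk>g \<in> G; x \<in> topspace T; y \<in> topspace T; z \<in> topspace T;
                    D g x y \<le> \<epsilon>; D g y z \<le> \<epsilon>\<rbrakk> \<Longrightarrow> D g x z \<le> \<epsilon>"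
    and open_D: "\<And>g x. g \<in> G \<Longrightarrow> x \<in> topspace T \<Longrightarrow> openin T {y \<in> topspace T. D g x y \<le> \<epsilon>}"
    and separating: "\<And>x y. \<lbrakk>x \<in> topspace T; y \<in> topspace T; \<And>g. g \<in> G \<Longrightarrow> D g x y \<le> \<epsilon>\<rbrakk> \<Longrightarrow> x = y"
    and continuous_F: "\<And>g. g \<in> G \<Longrightarrow> continuous_map T euclideanreal (F g)"
    and summable_F: "\<And>\<Lambda> x y. \<lbrakk>finite \<Lambda>; \<Lambda> \<subseteq> G; x \<in> topspace T; y \<in> topspace T;
                       \<And>g. g \<in> G - \<Lambda> \<Longrightarrow> D g x y \<le> \<epsilon>\<rbrakk> \<Longrightarrow> (\<lambda>g. F g y - F g x) summable_on G"
begin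

section \<open>Cylinders as equivalence classes\<close>

lemma dist_on_le_iff:
  assumes "\<Lambda> \<subseteq> G" "x \<in> topspace T" "y \<in> topspace T"
  shows "dist_on \<Lambda> x y \<le> \<epsilon> \<longleftrightarrow> (\<forall>g\<in>\<Lambda>. D g x y \<le> \<epsilon>)"
proof (cases "\<Lambda> = {}")
  case True
  then show ?thesis using eps_nonneg by (simp add: dist_on_def)
next
  case False
  have "bdd_above ((\<lambda>g. D g x y) ` \<Lambda>)"
    using bdd_D[OF assms(2,3)] assms(1) by (meson bdd_above_mono image_mono)
  then show ?thesis using False by (simp add: dist_on_def cSUP_le_iff)
qed

lemma mem_cyl:
  "\<Lambda> \<subseteq> G \<Longrightarrow> x \<in> topspace T \<Longrightarrow> y \<in> cyl \<Lambda> x \<longleftrightarrow> y \<in> topspace T \<and> (\<forall>g\<in>\<Lambda>. D g x y \<le> \<epsilon>)"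
  using dist_on_le_iff by (auto simp: cyl_def)

lemma mem_W:
  "x \<in> topspace T \<Longrightarrow> y \<in> W \<Lambda> x \<longleftrightarrow> y \<in> topspace T \<and> (\<forall>g\<in>G - \<Lambda>. D g x y \<le> \<epsilon>)"
  using dist_on_le_iff[of "G - \<Lambda>"] by (auto simp: W_def)

lemma W_eq_cyl: "W \<Lambda> x = cyl (G - \<Lambda>) x"
  by (simp add: W_def cyl_def)

lemma cyl_subset: "cyl \<Lambda> x \<subseteq> topspace T"
  by (auto simp: cyl_def)

lemma W_subset: "W \<Lambda> x \<subseteq> topspace T"
  by (auto simp: W_def)

lemma cyl_refl: "\<Lambda> \<subseteq> G \<Longrightarrow> x \<in> topspace T \<Longrightarrow> x \<in> cyl \<Lambda> x"
  using D_refl by (auto simp: mem_cyl)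

text \<open>Closeness at all sites of \<Lambda> is an equivalence relation, so any point of a class
  can serve as its centre.\<close>

lemma cyl_eq:
  assumes "\<Lambda> \<subseteq> G" "x \<in> topspace T" "y \<in> cyl \<Lambda> x"
  shows "cyl \<Lambda> y = cyl \<Lambda> x"
proof -
  have y: "y \<in> topspace T" "\<And>g. g \<in> \<Lambda> \<Longrightarrow> D g x y \<le> \<epsilon>"
    using assms by (auto simp: mem_cyl)
  then have y': "\<And>g. g \<in> \<Lambda> \<Longrightarrow> D g y x \<le> \<epsilon>"
    using D_sym assms by (metis subsetD)
  have x: "x \<in> topspace T" and \<Lambda>: "\<And>g. g \<in> \<Lambda> \<Longrightarrow> g \<in> G" using assms by auto
  have "z \<in> cyl \<Lambda> y \<longleftrightarrow> z \<in> cyl \<Lambda> x" for z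
    unfolding mem_cyl[OF assms(1) x] mem_cyl[OF assms(1) y(1)]
    using D_trans[OF \<Lambda> x y(1)] D_trans[OF \<Lambda> y(1) x] y(2) y'
    by metis
  then show ?thesis by blast
qed

lemma W_refl: "x \<in> topspace T \<Longrightarrow> x \<in> W \<Lambda> x"
  by (simp add: W_eq_cyl cyl_refl)

lemma W_eq: "x \<in> topspace T \<Longrightarrow> y \<in> W \<Lambda> x \<Longrightarrow> W \<Lambda> y = W \<Lambda> x"
  by (metis W_eq_cyl cyl_eq Diff_subset)

text \<open>Two such points are close at the sites of \<Lambda> through the common cylinder and at
  all other sites through the common class \<open>W \<Lambda> x\<close>, so they cannot be
  separated.\<close>

lemma cyl_inter_W_unique:
  assumes "\<Lambda> \<subseteq> G" "u \<in> topspace T" "x \<in> topspace T"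
    and y: "y \<in> cyl \<Lambda> u \<inter> W \<Lambda> x" and z: "z \<in> cyl \<Lambda> u \<inter> W \<Lambda> x"
  shows "y = z"
proof -
  have yz: "y \<in> topspace T" "z \<in> topspace T" using y z W_subset by auto
  have "z \<in> cyl \<Lambda> y" "z \<in> W \<Lambda> y"
    using y z cyl_eq[OF assms(1,2), of y] W_eq[OF assms(3), of y \<Lambda>] by blast+
  then show ?thesis
    using yz assms(1) by (intro separating) (auto simp: mem_cyl mem_W)
qed

section \<open>Clopen cylinders and compactness\<close>

lemma openin_cyl:
  assumes "finite \<Lambda>" "\<Lambda> \<subseteq> G" "x \<in> topspace T"
  shows "openin T (cyl \<Lambda> x)"
proof -
  have "cyl \<Lambda> x = (\<Inter>g\<in>\<Lambda>. {y \<in> topspace T. D g x y \<le> \<epsilon>}) \<inter> topspace T"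
    using assms by (auto simp: mem_cyl)
  also have "openin T \<dots>"
    using assms open_D by (intro openin_INT) auto
  finally show ?thesis .
qed

text \<open>The complement of a class is the union of the other classes, each of which is
  open.\<close>

lemma closedin_cyl:
  assumes "finite \<Lambda>" "\<Lambda> \<subseteq> G" "x \<in> topspace T"
  shows "closedin T (cyl \<Lambda> x)"
proof -
  have "topspace T - cyl \<Lambda> x = (\<Union>y\<in>topspace T - cyl \<Lambda> x. cyl \<Lambda> y)" (is "?L = ?R")
  proof
    show "?L \<subseteq> ?R" using cyl_refl assms by blast
    show "?R \<subseteq> ?L"
    proof
      fix z assume "z \<in> ?R"
      then obtain y where y: "y \<in> topspace T" "y \<notin> cyl \<Lambda> x" "z \<in> cyl \<Lambda> y" by blast
      then have "cyl \<Lambda> z = cyl \<Lambda> y" "y \<in> cyl \<Lambda> y" "z \<in> topspace T"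
        using cyl_eq[OF assms(2) y(1,3)] cyl_refl[OF assms(2)] cyl_subset[of \<Lambda> y] by blast+
      then have "z \<notin> cyl \<Lambda> x"
        using cyl_eq[of \<Lambda> x z] assms(2,3) y(2) by auto
      then show "z \<in> ?L" using \<open>z \<in> topspace T\<close> by simp
    qed
  qed
  moreover have "openin T (\<Union>y\<in>topspace T - cyl \<Lambda> x. cyl \<Lambda> y)"
    using openin_cyl assms by blast
  ultimately show ?thesis
    using cyl_subset by (simp add: closedin_def)
qed

text \<open>The classes form an open partition of a compact space. As they are disjoint, a finite
  subcover must contain all of them.\<close>

lemma finite_cyl_image:
  assumes "finite \<Lambda>" "\<Lambda> \<subseteq> G"
  shows "finite (cyl \<Lambda> ` topspace T)"
proof -
  have "\<And>U. U \<in> cyl \<Lambda> ` topspace T \<Longrightarrow> openin T U" "topspace T \<subseteq> \<Union>(cyl \<Lambda> ` topspace T)"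
    using assms openin_cyl cyl_refl by blast+
  then obtain \<F> where \<F>: "finite \<F>" "\<F> \<subseteq> cyl \<Lambda> ` topspace T" "topspace T \<subseteq> \<Union>\<F>"
    using compact_T unfolding compact_space_def compactin_def by meson
  have "cyl \<Lambda> ` topspace T \<subseteq> \<F>"
  proof
    fix C assume "C \<in> cyl \<Lambda> ` topspace T"
    then obtain x where x: "x \<in> topspace T" "C = cyl \<Lambda> x" by blast
    from x \<F>(3) obtain C' where C': "C' \<in> \<F>" "x \<in> C'" by blast
    with \<F>(2) obtain y where "y \<in> topspace T" "C' = cyl \<Lambda> y" by blast
    then show "C \<in> \<F>" using x(2) C' cyl_eq[OF assms(2), of y x] by simp
  qed
  then show ?thesis using \<F>(1) by (rule finite_subset)
qed

text \<open>For each site of \<open>K\<close> the points of the space separated from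
  \<open>x\<close> there form an open set. These sets cover the compact set \<open>C\<close>, and a
  finite subcover gives the sites.\<close>

lemma finite_separating_sites:
  assumes "closedin T C" "x \<in> topspace T" "K \<subseteq> G" and sep: "\<And>y. y \<in> C \<Longrightarrow> \<exists>g\<in>K. \<not> D g x y \<le> \<epsilon>"
  obtains K' where "finite K'" "K' \<subseteq> K" "\<And>y. y \<in> C \<Longrightarrow> \<exists>g\<in>K'. \<not> D g x y \<le> \<epsilon>"
proof -
  define V where "V g = topspace T - cyl {g} x" for g
  have "compactin T C"
    using compact_T assms(1) closedin_compact_space by blast
  moreover have "\<And>U. U \<in> V ` K \<Longrightarrow> openin T U"
    using closedin_cyl assms(2,3) by (auto simp: V_def intro!: openin_diff)
  moreover have "C \<subseteq> \<Union>(V ` K)"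
  proof
    fix y assume "y \<in> C"
    with sep obtain g where g: "g \<in> K" "\<not> D g x y \<le> \<epsilon>" by blast
    have "{g} \<subseteq> G" using g(1) assms(3) by blast
    then have "y \<in> V g"
      using \<open>y \<in> C\<close> g(2) assms(2) closedin_subset[OF assms(1)] by (auto simp: V_def mem_cyl)
    then show "y \<in> \<Union>(V ` K)" using g(1) by blast
  qed
  ultimately obtain \<F> where "finite \<F>" "\<F> \<subseteq> V ` K" "C \<subseteq> \<Union>\<F>"
    unfolding compactin_def by meson
  then obtain K' where K': "finite K'" "K' \<subseteq> K" "C \<subseteq> \<Union>(V ` K')"
    by (metis finite_subset_image)
  have "\<exists>g\<in>K'. \<not> D g x y \<le> \<epsilon>" if y: "y \<in> C" for y
  proof -
    from y K'(3) obtain g where g: "g \<in> K'" "y \<in> V g" by auto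
    then have "{g} \<subseteq> G" using K'(2) assms(3) by blast
    then show ?thesis
      using g assms(2) by (auto simp: V_def mem_cyl)
  qed
  then show ?thesis using that K'(1,2) by blast
qed

text \<open>The complement of \<open>U\<close> is closed and avoids \<open>x\<close>, so finitely
  many sites separate \<open>x\<close> from all of it.\<close>

lemma cyl_neighbourhood_base:
  assumes "openin T U" "x \<in> U"
  obtains \<Lambda> where "finite \<Lambda>" "\<Lambda> \<subseteq> G" "cyl \<Lambda> x \<subseteq> U"
proof -
  have x: "x \<in> topspace T" using assms openin_subset by blast
  have "\<exists>g\<in>G. \<not> D g x y \<le> \<epsilon>" if "y \<in> topspace T - U" for y
    using separating[OF x, of y] that assms(2) by blast
  moreover have "closedin T (topspace T - U)" using assms(1) by blast
  ultimately obtain K where "finite K" "K \<subseteq> G" "\<And>y. y \<in> topspace T - U \<Longrightarrow> \<exists>g\<in>K. \<not> D g x y \<le> \<epsilon>"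
    using finite_separating_sites[OF _ x order_refl, of "topspace T - U"] by metis
  then show ?thesis using x by (intro that[of K]) (simp_all add: subset_iff mem_cyl, blast)
qed

lemma countable_cylinders: "countable {cyl \<Lambda> x | \<Lambda> x. finite \<Lambda> \<and> \<Lambda> \<subseteq> G \<and> x \<in> topspace T}"
proof -
  have "{cyl \<Lambda> x | \<Lambda> x. finite \<Lambda> \<and> \<Lambda> \<subseteq> G \<and> x \<in> topspace T} =
      (\<Union>\<Lambda>\<in>{\<Lambda>. finite \<Lambda> \<and> \<Lambda> \<subseteq> G}. cyl \<Lambda> ` topspace T)"
    by blast
  moreover have "countable {\<Lambda>. finite \<Lambda> \<and> \<Lambda> \<subseteq> G}"
    using countable_Collect_finite_subset[OF countable_G] by (simp add: conj_commute)
  then have "countable (\<Union>\<Lambda>\<in>{\<Lambda>. finite \<Lambda> \<and> \<Lambda> \<subseteq> G}. cyl \<Lambda> ` topspace T)"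
    using finite_cyl_image by (intro countable_UN) (simp_all add: countable_finite)
  ultimately show ?thesis by simp
qed

section \<open>Borel sets and saturations of closed sets\<close>

definition clopens :: "'x set set" where
  "clopens = {C. openin T C \<and> closedin T C}"

lemma space_borel_on [simp]: "space (borel_on T) = topspace T"
  unfolding borel_on_def by (rule space_measure_of) (auto dest: openin_subset)

lemma sets_borel_on: "sets (borel_on T) = sigma_sets (topspace T) {U. openin T U}"
  unfolding borel_on_def by (rule sets_measure_of) (auto dest: openin_subset)

lemma openin_sets: "openin T U \<Longrightarrow> U \<in> sets (borel_on T)"
  by (auto simp: sets_borel_on)

lemma closedin_sets: "closedin T C \<Longrightarrow> C \<in> sets (borel_on T)"
  using openin_sets[of "topspace T - C"] sets.compl_sets[of "topspace T - C" "borel_on T"]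
  by (auto simp: closedin_def double_diff)

lemma cyl_sets: "finite \<Lambda> \<Longrightarrow> \<Lambda> \<subseteq> G \<Longrightarrow> x \<in> topspace T \<Longrightarrow> cyl \<Lambda> x \<in> sets (borel_on T)"
  by (intro openin_sets openin_cyl)

text \<open>An open set is the union of the cylinders inside it, and there are only countably many
  cylinders. The clopen sets are preferred as generators because they are closed under intersection
  and their indicators are continuous.\<close>

lemma sets_borel_on_clopens: "sets (borel_on T) = sigma_sets (topspace T) clopens"
proof
  show "sets (borel_on T) \<subseteq> sigma_sets (topspace T) clopens"
    unfolding sets_borel_on
  proof (rule sigma_sets_mono, clarify)
    fix U assume U: "openin T U"
    let ?\<C> = "{C \<in> {cyl \<Lambda> x | \<Lambda> x. finite \<Lambda> \<and> \<Lambda> \<subseteq> G \<and> x \<in> topspace T}. C \<subseteq> U}"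
    have "U \<subseteq> \<Union>?\<C>"
    proof
      fix x assume "x \<in> U"
      then obtain \<Lambda> where "finite \<Lambda>" "\<Lambda> \<subseteq> G" "cyl \<Lambda> x \<subseteq> U" "x \<in> topspace T"
        using U openin_subset by (metis cyl_neighbourhood_base subsetD)
      then show "x \<in> \<Union>?\<C>" using cyl_refl by blast
    qed
    then have "U = \<Union>?\<C>" by blast
    moreover have "countable ?\<C>"
      using countable_cylinders by (rule countable_subset[rotated]) blast
    moreover have "?\<C> \<subseteq> sigma_sets (topspace T) clopens"
      using openin_cyl closedin_cyl by (auto simp: clopens_def)
    ultimately show "U \<in> sigma_sets (topspace T) clopens"
      by (metis (no_types, lifting) sigma_sets_UNION subsetD)
  qed
  show "sigma_sets (topspace T) clopens \<subseteq> sets (borel_on T)"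
    unfolding sets_borel_on by (rule sigma_sets_mono') (auto simp: clopens_def)
qed

text \<open>If \<open>W \<Lambda> x\<close> misses \<open>C\<close>, a finite set \<open>K\<close>
  of sites outside \<Lambda> already separates \<open>x\<close> from \<open>C\<close>. By
  transitivity it separates every point of \<open>cyl K x\<close> from \<open>C\<close>, so the
  complement of the saturation is open. This is the source of measurability for the swaps.\<close>

lemma closedin_saturation:
  assumes C: "closedin T C"
  shows "closedin T {x \<in> topspace T. C \<inter> W \<Lambda> x \<noteq> {}}" (is "closedin T ?S")
proof -
  have "\<exists>U. openin T U \<and> x \<in> U \<and> U \<subseteq> topspace T - ?S" if "x \<in> topspace T - ?S" for x
  proof -
    have x: "x \<in> topspace T" using that by simp
    have "C \<inter> W \<Lambda> x = {}" using that by blast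
    then have "\<exists>g\<in>G - \<Lambda>. \<not> D g x y \<le> \<epsilon>" if "y \<in> C" for y
      using that closedin_subset[OF C] x mem_W[OF x, of y \<Lambda>] by blast
    then obtain K where K: "finite K" "K \<subseteq> G - \<Lambda>" "\<And>y. y \<in> C \<Longrightarrow> \<exists>g\<in>K. \<not> D g x y \<le> \<epsilon>"
      using finite_separating_sites[OF C x, of "G - \<Lambda>"] by auto
    have "C \<inter> W \<Lambda> z = {}" if z: "z \<in> cyl K x" for z
    proof -
      have zX: "z \<in> topspace T" using z cyl_subset by blast
      { fix y assume y: "y \<in> C" "y \<in> W \<Lambda> z"
        then obtain g where g: "g \<in> K" "\<not> D g x y \<le> \<epsilon>" using K(3) by blast
        have "D g x z \<le> \<epsilon>" "D g z y \<le> \<epsilon>" "g \<in> G" "y \<in> topspace T"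
          using g(1) z y K(2) x zX mem_cyl[of K x z] by (auto simp: mem_W)
        then have False using D_trans[of g x z y] g x zX by blast }
      then show ?thesis by blast
    qed
    moreover have "K \<subseteq> G" using K(2) by blast
    then have "openin T (cyl K x)" "x \<in> cyl K x"
      using openin_cyl[OF K(1)] cyl_refl x by blast+
    ultimately have "openin T (cyl K x) \<and> x \<in> cyl K x \<and> cyl K x \<subseteq> topspace T - ?S"
      using cyl_subset[of K x] by blast
    then show ?thesis by blast
  qed
  then have "openin T (topspace T - ?S)" by (subst openin_subopen) auto
  then show ?thesis by (auto simp: closedin_def)
qed

section \<open>The cocycle, the kernel and the swaps\<close>

text \<open>Sending a point of \<open>W \<Lambda> x\<close> to its cylinder is injective, and there
  are finitely many cylinders.\<close>

lemma finite_W: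
  assumes "finite \<Lambda>" "\<Lambda> \<subseteq> G" "x \<in> topspace T"
  shows "finite (W \<Lambda> x)"
proof (rule inj_on_finite)
  show "inj_on (cyl \<Lambda>) (W \<Lambda> x)"
  proof (rule inj_onI)
    fix y z assume yz: "y \<in> W \<Lambda> x" "z \<in> W \<Lambda> x" "cyl \<Lambda> y = cyl \<Lambda> z"
    then have yz': "y \<in> topspace T" "z \<in> topspace T" using W_subset by blast+
    then have "y \<in> cyl \<Lambda> y \<inter> W \<Lambda> x" "z \<in> cyl \<Lambda> y \<inter> W \<Lambda> x"
      using yz cyl_refl[OF assms(2) yz'(1)] cyl_refl[OF assms(2) yz'(2)] by auto
    then show "y = z" by (rule cyl_inter_W_unique[OF assms(2) yz'(1) assms(3)])
  qed
  show "cyl \<Lambda> ` W \<Lambda> x \<subseteq> cyl \<Lambda> ` topspace T" by (intro image_mono W_subset)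
  show "finite (cyl \<Lambda> ` topspace T)" using finite_cyl_image assms by blast
qed

lemma summable_psi:
  assumes "finite \<Lambda>" "\<Lambda> \<subseteq> G" "x \<in> topspace T" "y \<in> W \<Lambda> x"
  shows "(\<lambda>g. F g y - F g x) summable_on G"
  using assms(3,4) mem_W[OF assms(3)] by (intro summable_F[OF assms(1,2)]) auto

text \<open>The summands telescope at each site; membership in a common class supplies the
  summability needed to add the two sums.\<close>

lemma psi_add:
  assumes "finite \<Lambda>" "\<Lambda> \<subseteq> G" "x \<in> topspace T" "y \<in> W \<Lambda> x" "z \<in> W \<Lambda> x"
  shows "psi x y + psi y z = psi x z"
proof -
  have y: "y \<in> topspace T" "z \<in> W \<Lambda> y"
    using W_subset assms(4,5) W_eq[OF assms(3,4)] by auto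
  have "psi x y + psi y z = (\<Sum>\<^sub>\<infinity>g\<in>G. (F g y - F g x) + (F g z - F g y))"
    unfolding psi_def
    by (intro infsum_add[symmetric] summable_psi[OF assms(1,2)] assms y)
  then show ?thesis by (simp add: psi_def)
qed

lemma psi_self [simp]: "psi x x = 0"
  by (simp add: psi_def)

lemma kern_nonneg: "0 \<le> kern \<Lambda> x y"
  by (simp add: kern_def sum_nonneg)

lemma partition_function_pos:
  assumes "finite \<Lambda>" "\<Lambda> \<subseteq> G" "x \<in> topspace T"
  shows "0 < (\<Sum>y\<in>W \<Lambda> x. exp (psi x y))"
  using finite_W[OF assms] W_refl[OF assms(3)] by (intro sum_pos) auto

lemma sum_kern:
  assumes "finite \<Lambda>" "\<Lambda> \<subseteq> G" "x \<in> topspace T"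
  shows "(\<Sum>y\<in>W \<Lambda> x. kern \<Lambda> x y) = 1"
  using partition_function_pos[OF assms] by (simp add: kern_def sum_divide_distrib[symmetric])

text \<open>Both kernels have the same denominator, which depends on \<open>x\<close> alone, and the
  numerators are related by the cocycle identity.\<close>

lemma kern_mult_exp:
  assumes "finite \<Lambda>" "\<Lambda> \<subseteq> G" "x \<in> topspace T" "y \<in> W \<Lambda> x" "z \<in> W \<Lambda> x"
  shows "kern \<Lambda> x y * exp (psi y z) = kern \<Lambda> x z"
  by (simp add: kern_def flip: psi_add[OF assms] exp_add)

lemma detailed_balance:
  assumes "finite \<Lambda>" "\<Lambda> \<subseteq> G" "x \<in> topspace T" "y \<in> W \<Lambda> x"
  shows "exp (psi x y) * kern \<Lambda> y x = kern \<Lambda> x y"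
proof -
  have x: "x \<in> W \<Lambda> x" by (rule W_refl[OF assms(3)])
  \<comment> \<open>The partition functions at two points of one class differ by the factor
    \<open>exp (psi x y)\<close>.\<close>
  have "(\<Sum>z\<in>W \<Lambda> x. exp (psi x z)) = exp (psi x y) * (\<Sum>z\<in>W \<Lambda> y. exp (psi y z))"
    unfolding sum_distrib_left W_eq[OF assms(3,4)] exp_add[symmetric]
    by (intro sum.cong refl) (simp add: psi_add[OF assms])
  moreover have "exp (psi y x) * exp (psi x y) = 1"
    using psi_add[OF assms x] by (simp flip: exp_add add: add.commute)
  ultimately show ?thesis
    by (simp add: kern_def divide_simps) (simp add: ac_simps)
qed

section \<open>The swaps as measurable involutions\<close>

definition swap_dom :: "'g set \<Rightarrow> 'x \<Rightarrow> 'x \<Rightarrow> 'x set" where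
  "swap_dom \<Lambda> u v = {x \<in> cyl \<Lambda> u. cyl \<Lambda> v \<inter> W \<Lambda> x \<noteq> {}}"

lemma swap_dom_subset: "swap_dom \<Lambda> u v \<subseteq> topspace T"
  using cyl_subset by (auto simp: swap_dom_def)

lemma swap_dom_sets:
  assumes "finite \<Lambda>" "\<Lambda> \<subseteq> G" "u \<in> topspace T" "v \<in> topspace T"
  shows "swap_dom \<Lambda> u v \<in> sets (borel_on T)"
proof -
  have "swap_dom \<Lambda> u v = cyl \<Lambda> u \<inter> {x \<in> topspace T. cyl \<Lambda> v \<inter> W \<Lambda> x \<noteq> {}}"
    using cyl_subset by (auto simp: swap_dom_def)
  then show ?thesis
    using assms by (auto intro!: sets.Int cyl_sets closedin_sets closedin_saturation closedin_cyl)
qed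

context
  fixes \<Lambda> u v
  assumes \<Lambda>: "finite \<Lambda>" "\<Lambda> \<subseteq> G" and u: "u \<in> topspace T" and v: "v \<in> topspace T"
begin

lemma swap_eqI:
  assumes "x \<in> cyl \<Lambda> u" "y \<in> cyl \<Lambda> v" "y \<in> W \<Lambda> x"
  shows "swap \<Lambda> u v x = y"
proof -
  have "x \<in> topspace T" using assms(1) cyl_subset by blast
  then have "(THE y. y \<in> cyl \<Lambda> v \<inter> W \<Lambda> x) = y"
    using cyl_inter_W_unique[OF \<Lambda>(2) v] assms by blast
  then show ?thesis using assms by (auto simp: swap_def)
qed

text \<open>Both branches of the definition can compete only at a point of both cylinders. There the
  point is its own unique partner, so either order returns it unchanged.\<close>

lemma swap_commute:
  assumes x: "x \<in> topspace T"
  shows "swap \<Lambda> u v x = swap \<Lambda> v u x"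
proof (cases "x \<in> cyl \<Lambda> u \<and> x \<in> cyl \<Lambda> v")
  case True
  have the: "(THE y. y \<in> cyl \<Lambda> w \<inter> W \<Lambda> x) = x" if "w \<in> topspace T" "x \<in> cyl \<Lambda> w" for w
    using cyl_inter_W_unique[OF \<Lambda>(2) that(1) x] that(2) W_refl[OF x] by blast
  show ?thesis
    using True W_refl[OF x, of \<Lambda>] the[OF u] the[OF v] by (auto simp: swap_def)
next
  case False
  then show ?thesis by (auto simp: swap_def)
qed

end

context
  fixes \<Lambda> u v
  assumes \<Lambda>: "finite \<Lambda>" "\<Lambda> \<subseteq> G" and u: "u \<in> topspace T" and v: "v \<in> topspace T"
begin

text \<open>A point is sent to its unique partner in the other cylinder within the same class.
  Partnership is symmetric, so \<open>swap \<Lambda> u v\<close> matches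
  \<open>swap_dom \<Lambda> u v\<close> with \<open>swap_dom \<Lambda> v u\<close>.\<close>

lemma swap_dom:
  assumes "x \<in> swap_dom \<Lambda> u v"
  shows "swap \<Lambda> u v x \<in> cyl \<Lambda> v \<inter> W \<Lambda> x"
    and "swap \<Lambda> u v x \<in> swap_dom \<Lambda> v u"
    and "swap \<Lambda> v u (swap \<Lambda> u v x) = x"
proof -
  have x: "x \<in> topspace T" "x \<in> cyl \<Lambda> u" using assms swap_dom_subset[of \<Lambda> u v] by (blast, simp add: swap_dom_def)
  from assms obtain y where y: "y \<in> cyl \<Lambda> v" "y \<in> W \<Lambda> x"
    by (auto simp: swap_dom_def)
  have eq: "swap \<Lambda> u v x = y" by (rule swap_eqI[OF \<Lambda> u v x(2) y])
  have xy: "x \<in> W \<Lambda> y" using W_eq[OF x(1) y(2)] W_refl[OF x(1)] by simp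
  show "swap \<Lambda> u v x \<in> cyl \<Lambda> v \<inter> W \<Lambda> x" using eq y by simp
  show "swap \<Lambda> u v x \<in> swap_dom \<Lambda> v u" using eq y xy x by (auto simp: swap_dom_def)
  show "swap \<Lambda> v u (swap \<Lambda> u v x) = x"
    unfolding eq by (rule swap_eqI[OF \<Lambda> v u y(1) x(2) xy])
qed

lemma swap_fixed:
  "x \<notin> swap_dom \<Lambda> u v \<Longrightarrow> x \<notin> swap_dom \<Lambda> v u \<Longrightarrow> swap \<Lambda> u v x = x"
  by (auto simp: swap_dom_def swap_def)

end

context
  fixes \<Lambda> u v
  assumes \<Lambda>: "finite \<Lambda>" "\<Lambda> \<subseteq> G" and u: "u \<in> topspace T" and v: "v \<in> topspace T"
begin

lemma swap_in_W_and_involutive: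
  assumes "x \<in> topspace T"
  shows "swap \<Lambda> u v x \<in> W \<Lambda> x \<and> swap \<Lambda> u v (swap \<Lambda> u v x) = x"
proof -
  consider "x \<in> swap_dom \<Lambda> u v" | "x \<in> swap_dom \<Lambda> v u"
    | "x \<notin> swap_dom \<Lambda> u v" "x \<notin> swap_dom \<Lambda> v u" by blast
  then show ?thesis
  proof cases
    case 1
    note s = swap_dom[OF \<Lambda> u v 1]
    then have "swap \<Lambda> u v x \<in> topspace T" using cyl_subset by blast
    then show ?thesis using s swap_commute[OF \<Lambda> u v] by auto
  next
    case 2
    note s = swap_dom[OF \<Lambda> v u 2]
    then show ?thesis using swap_commute[OF \<Lambda> u v assms] by auto
  next
    case 3
    then show ?thesis using swap_fixed[OF \<Lambda> u v] W_refl[OF assms] by auto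
  qed
qed

lemmas swap_in_W = swap_in_W_and_involutive[THEN conjunct1]
lemmas swap_swap = swap_in_W_and_involutive[THEN conjunct2]

lemma swap_in_topspace: "x \<in> topspace T \<Longrightarrow> swap \<Lambda> u v x \<in> topspace T"
  using swap_in_W W_subset by blast

text \<open>An involution has equal images and preimages, so images of Borel sets are Borel once the
  map is measurable.\<close>

lemma swap_image_eq_vimage:
  assumes "B \<subseteq> topspace T"
  shows "swap \<Lambda> u v ` B = swap \<Lambda> u v -` B \<inter> topspace T"
proof
  show "swap \<Lambda> u v ` B \<subseteq> swap \<Lambda> u v -` B \<inter> topspace T"
    using assms swap_swap swap_in_topspace by auto
  show "swap \<Lambda> u v -` B \<inter> topspace T \<subseteq> swap \<Lambda> u v ` B"
    using swap_swap by (auto intro: rev_image_eqI)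
qed

text \<open>The swap is an involution that stays within each class, which permits reindexing of sums
  over \<open>W \<Lambda> x\<close>.\<close>

lemma swap_bij_W:
  assumes x: "x \<in> topspace T"
  shows "bij_betw (swap \<Lambda> u v) (W \<Lambda> x) (W \<Lambda> x)"
proof (rule bij_betw_byWitness[where f' = "swap \<Lambda> u v"])
  have W: "y \<in> topspace T" "W \<Lambda> y = W \<Lambda> x" if "y \<in> W \<Lambda> x" for y
    using that W_subset W_eq[OF x] by auto
  show "\<forall>a\<in>W \<Lambda> x. swap \<Lambda> u v (swap \<Lambda> u v a) = a" "\<forall>a\<in>W \<Lambda> x. swap \<Lambda> u v (swap \<Lambda> u v a) = a"
    using swap_swap W(1) by blast+
  show "swap \<Lambda> u v ` W \<Lambda> x \<subseteq> W \<Lambda> x" "swap \<Lambda> u v ` W \<Lambda> x \<subseteq> W \<Lambda> x"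
    using swap_in_W W by fastforce+
qed

text \<open>It suffices to treat preimages of clopen sets. Such a preimage splits into the parts in
  the two swap domains, described by saturations of closed sets, and the part where the map is the
  identity.\<close>

lemma swap_measurable: "swap \<Lambda> u v \<in> borel_on T \<rightarrow>\<^sub>M borel_on T"
proof (rule measurable_sigma_sets[OF sets_borel_on_clopens])
  show "clopens \<subseteq> Pow (topspace T)" by (auto simp: clopens_def dest: openin_subset)
  show "swap \<Lambda> u v \<in> space (borel_on T) \<rightarrow> topspace T" using swap_in_topspace by simp
  fix B assume "B \<in> clopens"
  then have B: "closedin T B" "B \<subseteq> topspace T" by (auto simp: clopens_def dest: openin_subset)
  let ?sat = "\<lambda>C. {x \<in> topspace T. C \<inter> W \<Lambda> x \<noteq> {}}"
  \<comment> \<open>Uniqueness of the partner turns the condition on the image into the existence of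
    some point of \<open>B\<close> in the target cylinder and in the class of
    \<open>x\<close>.\<close>
  have one: "swap \<Lambda> a b x \<in> B \<longleftrightarrow> (cyl \<Lambda> b \<inter> B) \<inter> W \<Lambda> x \<noteq> {}"
    if x: "x \<in> swap_dom \<Lambda> a b" and ab: "a \<in> topspace T" "b \<in> topspace T" for x a b
  proof
    assume "swap \<Lambda> a b x \<in> B"
    then show "(cyl \<Lambda> b \<inter> B) \<inter> W \<Lambda> x \<noteq> {}" using swap_dom(1)[OF \<Lambda> ab x] by blast
  next
    assume "(cyl \<Lambda> b \<inter> B) \<inter> W \<Lambda> x \<noteq> {}"
    then obtain y where y: "y \<in> cyl \<Lambda> b" "y \<in> W \<Lambda> x" "y \<in> B" by blast
    have "x \<in> cyl \<Lambda> a" using x by (simp add: swap_dom_def)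
    then show "swap \<Lambda> a b x \<in> B" using swap_eqI[OF \<Lambda> ab _ y(1,2)] y(3) by simp
  qed
  have "swap \<Lambda> u v -` B \<inter> topspace T =
      (swap_dom \<Lambda> u v \<inter> ?sat (cyl \<Lambda> v \<inter> B)) \<union> (swap_dom \<Lambda> v u \<inter> ?sat (cyl \<Lambda> u \<inter> B)) \<union>
      (B - (swap_dom \<Lambda> u v \<union> swap_dom \<Lambda> v u))" (is "?L = ?R")
  proof (rule Set.set_eqI)
    fix x
    show "x \<in> ?L \<longleftrightarrow> x \<in> ?R"
    proof (cases "x \<in> topspace T")
      case False
      then show ?thesis using B(2) by blast
    next
      case True
      consider "x \<in> swap_dom \<Lambda> u v" "x \<in> swap_dom \<Lambda> v u" | "x \<in> swap_dom \<Lambda> u v" "x \<notin> swap_dom \<Lambda> v u"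
        | "x \<in> swap_dom \<Lambda> v u" "x \<notin> swap_dom \<Lambda> u v"
        | "x \<notin> swap_dom \<Lambda> u v" "x \<notin> swap_dom \<Lambda> v u" by blast
      then show ?thesis
      proof cases
        case 1
        then show ?thesis
          using one[OF 1(1) u v] one[OF 1(2) v u] swap_commute[OF \<Lambda> u v True] True by auto
      next
        case 2
        then show ?thesis using one[OF 2(1) u v] True by auto
      next
        case 3
        then show ?thesis
          using one[OF 3(1) v u] swap_commute[OF \<Lambda> u v True] True by auto
      next
        case 4
        then show ?thesis using swap_fixed[OF \<Lambda> u v] True by auto
      qed
    qed
  qed
  moreover have "?R \<in> sets (borel_on T)"
    using \<Lambda> u v B closedin_cyl
    by (intro sets.Un sets.Int sets.Diff swap_dom_sets closedin_sets closedin_saturation closedin_Int) auto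
  ultimately show "swap \<Lambda> u v -` B \<inter> space (borel_on T) \<in> sets (borel_on T)" by simp
qed

end

section \<open>Measurability of the cocycle along swaps\<close>

lemma continuous_map_borel_measurable:
  assumes "continuous_map T euclideanreal \<phi>"
  shows "\<phi> \<in> borel_measurable (borel_on T)"
proof (rule borel_measurableI)
  fix S :: "real set" assume "open S"
  then have "openin T {x \<in> topspace T. \<phi> x \<in> S}"
    using assms by (intro openin_continuous_map_preimage) auto
  moreover have "\<phi> -` S \<inter> space (borel_on T) = {x \<in> topspace T. \<phi> x \<in> S}" by auto
  ultimately show "\<phi> -` S \<inter> space (borel_on T) \<in> sets (borel_on T)"
    using openin_sets by simp
qed

text \<open>Along an enumeration of the sites the unordered sum becomes a pointwise convergent
  series of measurable functions.\<close>

lemma psi_swap_measurable: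
  assumes \<Lambda>: "finite \<Lambda>" "\<Lambda> \<subseteq> G" and uv: "u \<in> topspace T" "v \<in> topspace T"
  shows "(\<lambda>x. psi x (swap \<Lambda> u v x)) \<in> borel_measurable (borel_on T)"
proof -
  let ?e = "from_nat_into G"
  have e: "bij_betw ?e UNIV G"
    using countable_G infinite_G by (rule bij_betw_from_nat_into)
  then have eG: "?e n \<in> G" for n by (auto simp: bij_betw_def)
  have "psi x (swap \<Lambda> u v x) = (\<Sum>n. F (?e n) (swap \<Lambda> u v x) - F (?e n) x)"
    if x: "x \<in> topspace T" for x
  proof -
    have "((\<lambda>g. F g (swap \<Lambda> u v x) - F g x) has_sum psi x (swap \<Lambda> u v x)) G"
      unfolding psi_def using summable_psi[OF \<Lambda> x swap_in_W[OF \<Lambda> uv x]] by (rule has_sum_infsum)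
    then have "((\<lambda>n. F (?e n) (swap \<Lambda> u v x) - F (?e n) x) has_sum psi x (swap \<Lambda> u v x)) UNIV"
      by (subst has_sum_reindex_bij_betw[OF e])
    then show ?thesis
      by (intro sums_unique has_sum_imp_sums)
  qed
  moreover have "(\<lambda>x. \<Sum>n. F (?e n) (swap \<Lambda> u v x) - F (?e n) x) \<in> borel_measurable (borel_on T)"
    using continuous_map_borel_measurable[OF continuous_F[OF eG]]
    by (intro borel_measurable_suminf borel_measurable_diff)
       (auto intro: measurable_compose[OF swap_measurable[OF \<Lambda> uv]])
  ultimately show ?thesis
    by (subst measurable_cong) auto
qed

section \<open>Transversals and sums over classes\<close>

definition transversal :: "'g set \<Rightarrow> 'x set \<Rightarrow> bool" where
  "transversal \<Lambda> Q \<longleftrightarrow> finite Q \<and> Q \<subseteq> topspace T \<and> (\<forall>x\<in>topspace T. \<exists>!q. q \<in> Q \<and> x \<in> cyl \<Lambda> q)"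

lemma transversal_exists:
  assumes "finite \<Lambda>" "\<Lambda> \<subseteq> G"
  obtains Q where "transversal \<Lambda> Q"
proof
  \<comment> \<open>The representative is chosen from the cylinder as a set, so all points of one
    cylinder yield the same representative.\<close>
  let ?r = "\<lambda>C. SOME x :: 'x. x \<in> C"
  let ?Q = "?r ` (cyl \<Lambda> ` topspace T)"
  have r: "?r (cyl \<Lambda> x) \<in> cyl \<Lambda> x" if "x \<in> topspace T" for x
    using cyl_refl[OF assms(2) that] by (rule someI)
  have cr: "cyl \<Lambda> (?r (cyl \<Lambda> x)) = cyl \<Lambda> x" if "x \<in> topspace T" for x
    by (rule cyl_eq[OF assms(2) that r[OF that]])
  show "transversal \<Lambda> ?Q"
    unfolding transversal_def
  proof (intro conjI ballI)
    show "finite ?Q" using finite_cyl_image[OF assms] by blast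
    show "?Q \<subseteq> topspace T" using r cyl_subset by blast
    fix x assume x: "x \<in> topspace T"
    show "\<exists>!q. q \<in> ?Q \<and> x \<in> cyl \<Lambda> q"
    proof (rule ex1I)
      show "?r (cyl \<Lambda> x) \<in> ?Q \<and> x \<in> cyl \<Lambda> (?r (cyl \<Lambda> x))"
        using x cr[OF x] cyl_refl[OF assms(2) x] by simp
      fix q assume q: "q \<in> ?Q \<and> x \<in> cyl \<Lambda> q"
      then obtain y where y: "y \<in> topspace T" "q = ?r (cyl \<Lambda> y)" by blast
      then have "x \<in> cyl \<Lambda> y" using q cr[OF y(1)] by simp
      then show "q = ?r (cyl \<Lambda> x)" using cyl_eq[OF assms(2) y(1)] y(2) by simp
    qed
  qed
qed

text \<open>The index set \<open>W \<Lambda> x\<close> varies with \<open>x\<close>; the double sum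
  has a fixed finite index set. This is what makes such sums measurable and lets integrals pass
  inside.\<close>

lemma sum_W_eq_sum_swap:
  fixes H :: "'x \<Rightarrow> 'c :: {semiring_1}"
  assumes \<Lambda>: "finite \<Lambda>" "\<Lambda> \<subseteq> G" and Q: "transversal \<Lambda> Q" and x: "x \<in> topspace T"
  shows "(\<Sum>y\<in>W \<Lambda> x. H y) =
    (\<Sum>q\<in>Q. \<Sum>r\<in>Q. indicator (swap_dom \<Lambda> q r) x * H (swap \<Lambda> q r x))"
proof -
  have finQ: "finite Q" and QX: "q \<in> Q \<Longrightarrow> q \<in> topspace T" for q
    using Q by (auto simp: transversal_def)
  have ex1: "\<exists>!q. q \<in> Q \<and> y \<in> cyl \<Lambda> q" if "y \<in> topspace T" for y
    using Q that by (auto simp: transversal_def)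
  obtain p where p: "p \<in> Q" "x \<in> cyl \<Lambda> p" using ex1[OF x] by blast
  have p_unique: "x \<in> cyl \<Lambda> q \<longleftrightarrow> q = p" if "q \<in> Q" for q
    using ex1[OF x] p that by blast
  let ?R = "{r \<in> Q. x \<in> swap_dom \<Lambda> p r}"
  \<comment> \<open>Only the representative \<open>p\<close> of the cylinder containing
    \<open>x\<close> contributes.\<close>
  have "(\<Sum>q\<in>Q. \<Sum>r\<in>Q. indicator (swap_dom \<Lambda> q r) x * H (swap \<Lambda> q r x)) =
      (\<Sum>q\<in>Q. if q = p then \<Sum>r\<in>Q. indicator (swap_dom \<Lambda> p r) x * H (swap \<Lambda> p r x) else 0)"
    using p_unique by (intro sum.cong refl) (auto simp: swap_dom_def indicator_def)
  also have "\<dots> = (\<Sum>r\<in>Q. indicator (swap_dom \<Lambda> p r) x * H (swap \<Lambda> p r x))"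
    using finQ p(1) by simp
  also have "\<dots> = (\<Sum>r\<in>?R. H (swap \<Lambda> p r x))"
    using finQ by (intro sum.mono_neutral_cong_right) (auto simp: indicator_def)
  \<comment> \<open>Each point of \<open>W \<Lambda> x\<close> lies in the cylinder of exactly one
    representative \<open>r\<close> and equals \<open>swap \<Lambda> p r x\<close>, so the remaining
    sum runs over \<open>W \<Lambda> x\<close> without repetition.\<close>
  also have "\<dots> = (\<Sum>y\<in>W \<Lambda> x. H y)"
  proof (rule sum.reindex_bij_betw, rule bij_betwI')
    fix r r' assume r: "r \<in> ?R" "r' \<in> ?R"
    then have "swap \<Lambda> p r x \<in> cyl \<Lambda> r" "swap \<Lambda> p r' x \<in> cyl \<Lambda> r'" "swap \<Lambda> p r x \<in> topspace T"
      using swap_dom(1)[OF \<Lambda> QX[OF p(1)] QX] W_subset by blast+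
    then show "swap \<Lambda> p r x = swap \<Lambda> p r' x \<longleftrightarrow> r = r'"
      using ex1[of "swap \<Lambda> p r x"] r by auto
  next
    fix r assume "r \<in> ?R"
    then show "swap \<Lambda> p r x \<in> W \<Lambda> x"
      using swap_dom(1)[OF \<Lambda> QX[OF p(1)] QX] by blast
  next
    fix y assume y: "y \<in> W \<Lambda> x"
    then obtain r where r: "r \<in> Q" "y \<in> cyl \<Lambda> r" using ex1 W_subset by blast
    then have "x \<in> swap_dom \<Lambda> p r" using p(2) y by (auto simp: swap_dom_def)
    moreover have "swap \<Lambda> p r x = y"
      by (rule swap_eqI[OF \<Lambda> QX[OF p(1)] QX[OF r(1)] p(2) r(2) y])
    ultimately show "\<exists>r\<in>?R. y = swap \<Lambda> p r x" using r(1) by blast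
  qed
  finally show ?thesis by simp
qed

section \<open>Gibbs measures and conformal measures\<close>

text \<open>The counterpart of \<open>M\<close> for functions with values in \<open>ennreal\<close>,
  where no integrability has to be checked.\<close>

definition kernel_integral :: "'g set \<Rightarrow> ('x \<Rightarrow> ennreal) \<Rightarrow> 'x \<Rightarrow> ennreal" where
  "kernel_integral \<Lambda> h x = (\<Sum>y\<in>W \<Lambda> x. ennreal (kern \<Lambda> x y) * h y)"

text \<open>These are the Dobrushin-Lanford-Ruelle equations for all nonnegative Borel
  functions.\<close>

definition dlr_measure :: "'x measure \<Rightarrow> bool" where
  "dlr_measure \<mu> \<longleftrightarrow> (\<forall>\<Lambda> h. finite \<Lambda> \<and> \<Lambda> \<subseteq> G \<and> h \<in> borel_measurable (borel_on T) \<longrightarrow>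
     (\<integral>\<^sup>+x. h x \<partial>\<mu>) = (\<integral>\<^sup>+x. kernel_integral \<Lambda> h x \<partial>\<mu>))"

text \<open>The numerator is covered by \<open>psi_swap_measurable\<close>; the partition function
  becomes a finite sum of such terms over pairs from a transversal.\<close>

lemma kern_swap_measurable:
  assumes \<Lambda>: "finite \<Lambda>" "\<Lambda> \<subseteq> G" and uv: "u \<in> topspace T" "v \<in> topspace T"
  shows "(\<lambda>x. kern \<Lambda> x (swap \<Lambda> u v x)) \<in> borel_measurable (borel_on T)"
proof -
  obtain Q where Q: "transversal \<Lambda> Q" using transversal_exists \<Lambda> by blast
  then have QX: "q \<in> Q \<Longrightarrow> q \<in> topspace T" for q by (auto simp: transversal_def)
  have "(\<lambda>x. \<Sum>q\<in>Q. \<Sum>r\<in>Q. indicator (swap_dom \<Lambda> q r) x * exp (psi x (swap \<Lambda> q r x)))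
      \<in> borel_measurable (borel_on T)"
    using swap_dom_sets[OF \<Lambda>] psi_swap_measurable[OF \<Lambda>] QX
    by (intro borel_measurable_sum borel_measurable_times borel_measurable_indicator borel_measurable_exp) auto
  then have "(\<lambda>x. \<Sum>y\<in>W \<Lambda> x. exp (psi x y)) \<in> borel_measurable (borel_on T)"
    by (subst measurable_cong[OF sum_W_eq_sum_swap[OF \<Lambda> Q]]) auto
  then show ?thesis
    unfolding kern_def using psi_swap_measurable[OF \<Lambda> uv]
    by (intro borel_measurable_divide) simp_all
qed

lemma M_measurable:
  assumes \<Lambda>: "finite \<Lambda>" "\<Lambda> \<subseteq> G" and \<phi>: "\<phi> \<in> borel_measurable (borel_on T)"
  shows "M \<Lambda> \<phi> \<in> borel_measurable (borel_on T)"
proof -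
  obtain Q where Q: "transversal \<Lambda> Q" using transversal_exists \<Lambda> by blast
  then have QX: "q \<in> Q \<Longrightarrow> q \<in> topspace T" for q by (auto simp: transversal_def)
  have "(\<lambda>x. \<Sum>q\<in>Q. \<Sum>r\<in>Q. indicator (swap_dom \<Lambda> q r) x *
        (\<phi> (swap \<Lambda> q r x) * kern \<Lambda> x (swap \<Lambda> q r x))) \<in> borel_measurable (borel_on T)"
    using swap_dom_sets[OF \<Lambda>] kern_swap_measurable[OF \<Lambda>] QX measurable_compose[OF swap_measurable[OF \<Lambda>] \<phi>]
    by (intro borel_measurable_sum borel_measurable_times borel_measurable_indicator) auto
  then show ?thesis
    unfolding M_def by (subst measurable_cong[OF sum_W_eq_sum_swap[OF \<Lambda> Q]]) auto
qed

lemma ennreal_M: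
  assumes "\<And>y. y \<in> topspace T \<Longrightarrow> 0 \<le> \<phi> y"
  shows "ennreal (M \<Lambda> \<phi> x) = kernel_integral \<Lambda> (\<lambda>y. ennreal (\<phi> y)) x"
proof -
  have "0 \<le> \<phi> y" if "y \<in> W \<Lambda> x" for y using assms that W_subset by blast
  then have "ennreal (M \<Lambda> \<phi> x) = (\<Sum>y\<in>W \<Lambda> x. ennreal (\<phi> y * kern \<Lambda> x y))"
    unfolding M_def by (intro sum_ennreal[symmetric] mult_nonneg_nonneg kern_nonneg)
  also have "\<dots> = kernel_integral \<Lambda> (\<lambda>y. ennreal (\<phi> y)) x"
    unfolding kernel_integral_def
    by (intro sum.cong refl) (simp add: ennreal_mult'' kern_nonneg mult.commute)
  finally show ?thesis .
qed

text \<open>The weights of the kernel sum to 1. This allows a bounded test function to be shifted to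
  a nonnegative one.\<close>

lemma M_add_const:
  assumes \<Lambda>: "finite \<Lambda>" "\<Lambda> \<subseteq> G" and x: "x \<in> topspace T"
  shows "M \<Lambda> (\<lambda>y. \<phi> y + K) x = M \<Lambda> \<phi> x + K"
  using sum_kern[OF assms]
  by (simp add: M_def algebra_simps sum.distrib flip: sum_distrib_left)

end

locale gibbs_system_measure = gibbs_system G T D \<epsilon> F
  for G :: "'g set" and T :: "'x topology" and D :: "'g \<Rightarrow> 'x \<Rightarrow> 'x \<Rightarrow> real"
    and \<epsilon> :: real and F :: "'g \<Rightarrow> 'x \<Rightarrow> real" +
  fixes \<mu> :: "'x measure"
  assumes borel_prob: "borel_prob_measure T \<mu>"
begin

sublocale prob_space \<mu>
  using borel_prob by (simp add: borel_prob_measure_def)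

lemma sets_mu [simp, measurable_cong]: "sets \<mu> = sets (borel_on T)"
  using borel_prob by (simp add: borel_prob_measure_def)

lemma space_mu [simp]: "space \<mu> = topspace T"
  using sets_eq_imp_space_eq[OF sets_mu] by simp

lemma measurable_mu [simp]: "\<mu> \<rightarrow>\<^sub>M N = borel_on T \<rightarrow>\<^sub>M N"
  by (rule measurable_cong_sets) simp_all

lemma measurable_mu' [simp]: "N \<rightarrow>\<^sub>M \<mu> = N \<rightarrow>\<^sub>M borel_on T"
  by (rule measurable_cong_sets) simp_all

text \<open>Measurability of \<open>k\<close> is required along swaps only, since these exhaust the
  pairs \<open>(x, y)\<close> with \<open>y\<close> in \<open>W \<Lambda> x\<close>.\<close>

lemma nn_integral_sum_W:
  fixes k :: "'x \<Rightarrow> 'x \<Rightarrow> ennreal"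
  assumes \<Lambda>: "finite \<Lambda>" "\<Lambda> \<subseteq> G" and Q: "transversal \<Lambda> Q"
    and k: "\<And>u v. u \<in> topspace T \<Longrightarrow> v \<in> topspace T \<Longrightarrow>
      (\<lambda>x. k x (swap \<Lambda> u v x)) \<in> borel_measurable (borel_on T)"
  shows "(\<integral>\<^sup>+x. (\<Sum>y\<in>W \<Lambda> x. k x y) \<partial>\<mu>) =
    (\<Sum>q\<in>Q. \<Sum>r\<in>Q. \<integral>\<^sup>+x. indicator (swap_dom \<Lambda> q r) x * k x (swap \<Lambda> q r x) \<partial>\<mu>)"
proof -
  have QX: "q \<in> topspace T" if "q \<in> Q" for q using Q that by (auto simp: transversal_def)
  have m: "(\<lambda>x. indicator (swap_dom \<Lambda> q r) x * k x (swap \<Lambda> q r x)) \<in> borel_measurable \<mu>"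
    if "q \<in> Q" "r \<in> Q" for q r
    using swap_dom_sets[OF \<Lambda>] k QX that by simp
  have "(\<integral>\<^sup>+x. (\<Sum>y\<in>W \<Lambda> x. k x y) \<partial>\<mu>) =
      (\<integral>\<^sup>+x. (\<Sum>q\<in>Q. \<Sum>r\<in>Q. indicator (swap_dom \<Lambda> q r) x * k x (swap \<Lambda> q r x)) \<partial>\<mu>)"
    using sum_W_eq_sum_swap[OF \<Lambda> Q] by (intro nn_integral_cong) simp
  also have "\<dots> = (\<Sum>q\<in>Q. \<Sum>r\<in>Q. \<integral>\<^sup>+x. indicator (swap_dom \<Lambda> q r) x * k x (swap \<Lambda> q r x) \<partial>\<mu>)"
    using m by (subst nn_integral_sum, force intro: borel_measurable_sum,
        intro sum.cong refl nn_integral_sum) auto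
  finally show ?thesis .
qed

text \<open>Conformality says that \<mu> is the image under the swap of the measure with density
  \<open>exp (psi x (swap \<Lambda> u v x))\<close> with respect to \<mu>; integrating against both
  descriptions gives the change of variables.\<close>

lemma gibbs_conformal_nn_integral:
  assumes conf: "gibbs_conformal_measure \<mu>"
    and \<Lambda>: "finite \<Lambda>" "\<Lambda> \<subseteq> G" and uv: "u \<in> topspace T" "v \<in> topspace T"
    and h: "h \<in> borel_measurable (borel_on T)"
  shows "(\<integral>\<^sup>+x. h x \<partial>\<mu>) = (\<integral>\<^sup>+x. ennreal (exp (psi x (swap \<Lambda> u v x))) * h (swap \<Lambda> u v x) \<partial>\<mu>)"
proof -
  let ?s = "swap \<Lambda> u v" and ?w = "\<lambda>x. ennreal (exp (psi x (swap \<Lambda> u v x)))"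
  have s: "?s \<in> borel_on T \<rightarrow>\<^sub>M borel_on T" by (rule swap_measurable[OF \<Lambda> uv])
  have w: "?w \<in> borel_measurable \<mu>" using psi_swap_measurable[OF \<Lambda> uv] by simp
  have s': "?s \<in> density \<mu> ?w \<rightarrow>\<^sub>M \<mu>" using s by simp
  have "\<mu> = distr (density \<mu> ?w) \<mu> ?s"
  proof (rule measure_eqI)
    fix B assume "B \<in> sets \<mu>"
    then have B: "B \<in> sets (borel_on T)" "B \<subseteq> topspace T"
      using sets.sets_into_space[of B "borel_on T"] by auto
    \<comment> \<open>Conformality speaks of images, so it is applied to the preimage of
      \<open>B\<close>, whose image is \<open>B\<close> again.\<close>
    let ?C = "?s -` B \<inter> topspace T"
    have C: "?C \<in> sets (borel_on T)" using measurable_sets[OF s B(1)] by simp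
    have "?s ` ?C = B"
      using swap_swap[OF \<Lambda> uv] swap_in_topspace[OF \<Lambda> uv] B(2) by (auto intro!: rev_image_eqI)
    then have "emeasure \<mu> B = (\<integral>\<^sup>+x\<in>?C. ?w x \<partial>\<mu>)"
      using conf \<Lambda> uv C unfolding gibbs_conformal_measure_def by metis
    also have "\<dots> = emeasure (distr (density \<mu> ?w) \<mu> ?s) B"
      using B C w s' by (simp add: emeasure_distr emeasure_density)
    finally show "emeasure \<mu> B = emeasure (distr (density \<mu> ?w) \<mu> ?s) B" .
  qed simp
  then have "(\<integral>\<^sup>+x. h x \<partial>\<mu>) = (\<integral>\<^sup>+x. h x \<partial>distr (density \<mu> ?w) \<mu> ?s)" by simp
  also have "\<dots> = (\<integral>\<^sup>+x. h (?s x) \<partial>density \<mu> ?w)"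
    using h by (intro nn_integral_distr s') simp
  also have "\<dots> = (\<integral>\<^sup>+x. ?w x * h (?s x) \<partial>\<mu>)"
    using w measurable_compose[OF s h] by (intro nn_integral_density) simp_all
  finally show ?thesis .
qed

text \<open>Mass transport: conformality allows the two ends of an edge of the equivalence relation
  \<open>y \<in> W \<Lambda> x\<close> to be exchanged at the cost of the cocycle.\<close>

lemma gibbs_conformal_transport:
  fixes k :: "'x \<Rightarrow> 'x \<Rightarrow> ennreal"
  assumes conf: "gibbs_conformal_measure \<mu>" and \<Lambda>: "finite \<Lambda>" "\<Lambda> \<subseteq> G"
    and k: "\<And>u v. u \<in> topspace T \<Longrightarrow> v \<in> topspace T \<Longrightarrow>
      (\<lambda>x. k x (swap \<Lambda> u v x)) \<in> borel_measurable (borel_on T)"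
  shows "(\<integral>\<^sup>+x. (\<Sum>y\<in>W \<Lambda> x. k x y) \<partial>\<mu>) =
    (\<integral>\<^sup>+x. (\<Sum>y\<in>W \<Lambda> x. ennreal (exp (psi x y)) * k y x) \<partial>\<mu>)"
proof -
  obtain Q where Q: "transversal \<Lambda> Q" using transversal_exists \<Lambda> by blast
  then have QX: "q \<in> Q \<Longrightarrow> q \<in> topspace T" for q by (auto simp: transversal_def)
  \<comment> \<open>Composition with the involution interchanges the two arguments of
    \<open>k\<close>, so the transposed function is measurable along swaps too.\<close>
  have kr: "(\<lambda>x. k (swap \<Lambda> u v x) x) \<in> borel_measurable (borel_on T)"
    if uv: "u \<in> topspace T" "v \<in> topspace T" for u v
  proof -
    have "(\<lambda>x. k (swap \<Lambda> u v x) (swap \<Lambda> u v (swap \<Lambda> u v x))) \<in> borel_measurable (borel_on T)"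
      using measurable_compose[OF swap_measurable[OF \<Lambda> uv] k[OF uv]] by simp
    then show ?thesis
      by (rule measurable_cong[THEN iffD1, rotated]) (simp add: swap_swap[OF \<Lambda> uv])
  qed
  \<comment> \<open>Changing variables by \<open>swap \<Lambda> q r\<close> carries the term of the
    pair \<open>(q, r)\<close> to the transposed term of \<open>(r, q)\<close>, with the cocycle as
    density.\<close>
  have exchange: "(\<integral>\<^sup>+x. indicator (swap_dom \<Lambda> q r) x * k x (swap \<Lambda> q r x) \<partial>\<mu>) =
      (\<integral>\<^sup>+x. indicator (swap_dom \<Lambda> r q) x *
        (ennreal (exp (psi x (swap \<Lambda> r q x))) * k (swap \<Lambda> r q x) x) \<partial>\<mu>)"
    if "q \<in> Q" "r \<in> Q" for q r
  proof -
    have qr: "q \<in> topspace T" "r \<in> topspace T" using QX that by auto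
    have "(\<lambda>x. indicator (swap_dom \<Lambda> q r) x * k x (swap \<Lambda> q r x)) \<in> borel_measurable (borel_on T)"
      using swap_dom_sets[OF \<Lambda> qr] k[OF qr] by simp
    note gibbs_conformal_nn_integral[OF conf \<Lambda> qr this]
    also have "(\<integral>\<^sup>+x. ennreal (exp (psi x (swap \<Lambda> q r x))) *
          (indicator (swap_dom \<Lambda> q r) (swap \<Lambda> q r x) *
             k (swap \<Lambda> q r x) (swap \<Lambda> q r (swap \<Lambda> q r x))) \<partial>\<mu>) =
        (\<integral>\<^sup>+x. indicator (swap_dom \<Lambda> r q) x *
          (ennreal (exp (psi x (swap \<Lambda> r q x))) * k (swap \<Lambda> r q x) x) \<partial>\<mu>)"
    proof (rule nn_integral_cong)
      fix x assume "x \<in> space \<mu>"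
      then have x: "x \<in> topspace T" by simp
      have c: "swap \<Lambda> r q y = swap \<Lambda> q r y" if "y \<in> topspace T" for y
        using swap_commute[OF \<Lambda> qr that] by simp
      have "swap \<Lambda> q r x \<in> swap_dom \<Lambda> q r \<longleftrightarrow> x \<in> swap_dom \<Lambda> r q"
        using swap_dom(2)[OF \<Lambda> qr, of "swap \<Lambda> q r x"] swap_dom(2)[OF \<Lambda> qr(2,1), of x]
          swap_swap[OF \<Lambda> qr x] c[OF x] by auto
      then show "ennreal (exp (psi x (swap \<Lambda> q r x))) *
          (indicator (swap_dom \<Lambda> q r) (swap \<Lambda> q r x) *
             k (swap \<Lambda> q r x) (swap \<Lambda> q r (swap \<Lambda> q r x))) =
        indicator (swap_dom \<Lambda> r q) x *
          (ennreal (exp (psi x (swap \<Lambda> r q x))) * k (swap \<Lambda> r q x) x)"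
        using c[OF x] swap_swap[OF \<Lambda> qr x] by (simp add: indicator_def)
    qed
    finally show ?thesis .
  qed
  have "(\<integral>\<^sup>+x. (\<Sum>y\<in>W \<Lambda> x. k x y) \<partial>\<mu>) =
      (\<Sum>q\<in>Q. \<Sum>r\<in>Q. \<integral>\<^sup>+x. indicator (swap_dom \<Lambda> r q) x *
        (ennreal (exp (psi x (swap \<Lambda> r q x))) * k (swap \<Lambda> r q x) x) \<partial>\<mu>)"
    by (subst nn_integral_sum_W[OF \<Lambda> Q]) (use k in \<open>auto intro!: sum.cong exchange\<close>)
  also have "\<dots> = (\<Sum>r\<in>Q. \<Sum>q\<in>Q. \<integral>\<^sup>+x. indicator (swap_dom \<Lambda> r q) x *
        (ennreal (exp (psi x (swap \<Lambda> r q x))) * k (swap \<Lambda> r q x) x) \<partial>\<mu>)"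
    by (rule sum.swap)
  also have "\<dots> = (\<integral>\<^sup>+x. (\<Sum>y\<in>W \<Lambda> x. ennreal (exp (psi x y)) * k y x) \<partial>\<mu>)"
    using psi_swap_measurable[OF \<Lambda>] kr
    by (intro nn_integral_sum_W[OF \<Lambda> Q, symmetric] borel_measurable_times_ennreal) auto
  finally show ?thesis .
qed

section \<open>Equivalence of conformality and the DLR equations\<close>

lemma gibbs_conformal_imp_dlr:
  assumes "gibbs_conformal_measure \<mu>"
  shows "dlr_measure \<mu>"
  unfolding dlr_measure_def
proof (intro allI impI, elim conjE)
  fix \<Lambda> and h :: "'x \<Rightarrow> ennreal" assume \<Lambda>: "finite \<Lambda>" "\<Lambda> \<subseteq> G" and h: "h \<in> borel_measurable (borel_on T)"
  \<comment> \<open>The mass \<open>h x\<close> is spread over the class of \<open>x\<close>; the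
    total is unchanged because the kernel weights sum to 1.\<close>
  have "(\<integral>\<^sup>+x. h x \<partial>\<mu>) = (\<integral>\<^sup>+x. (\<Sum>y\<in>W \<Lambda> x. ennreal (kern \<Lambda> x y) * h x) \<partial>\<mu>)"
    using sum_kern[OF \<Lambda>]
    by (intro nn_integral_cong) (simp add: sum_ennreal kern_nonneg flip: sum_distrib_right)
  \<comment> \<open>Transport is applied to the function sending \<open>x\<close> and
    \<open>y\<close> to \<open>kern \<Lambda> x y * h x\<close>.\<close>
  also have "\<dots> = (\<integral>\<^sup>+x. (\<Sum>y\<in>W \<Lambda> x. ennreal (exp (psi x y)) * (ennreal (kern \<Lambda> y x) * h y)) \<partial>\<mu>)"
    using kern_swap_measurable[OF \<Lambda>] h by (intro gibbs_conformal_transport[OF assms \<Lambda>]) simp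
  also have "\<dots> = (\<integral>\<^sup>+x. kernel_integral \<Lambda> h x \<partial>\<mu>)"
    unfolding kernel_integral_def
  proof (intro nn_integral_cong sum.cong refl)
    fix x y assume "x \<in> space \<mu>" "y \<in> W \<Lambda> x"
    then have "exp (psi x y) * kern \<Lambda> y x = kern \<Lambda> x y" by (intro detailed_balance \<Lambda>) simp_all
    then show "ennreal (exp (psi x y)) * (ennreal (kern \<Lambda> y x) * h y) = ennreal (kern \<Lambda> x y) * h y"
      by (simp flip: ennreal_mult' mult.assoc add: kern_nonneg)
  qed
  finally show "(\<integral>\<^sup>+x. h x \<partial>\<mu>) = (\<integral>\<^sup>+x. kernel_integral \<Lambda> h x \<partial>\<mu>)" .
qed

lemma dlr_imp_gibbs_conformal:
  assumes "dlr_measure \<mu>"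
  shows "gibbs_conformal_measure \<mu>"
  unfolding gibbs_conformal_measure_def
proof (intro allI impI ballI, elim conjE)
  fix \<Lambda> u v B
  assume \<Lambda>: "finite \<Lambda>" "\<Lambda> \<subseteq> G" and uv: "u \<in> topspace T" "v \<in> topspace T"
    and B: "B \<in> sets (borel_on T)"
  let ?s = "swap \<Lambda> u v"
  let ?w = "\<lambda>x. ennreal (exp (psi x (?s x)))"
  have dlr: "(\<integral>\<^sup>+x. h x \<partial>\<mu>) = (\<integral>\<^sup>+x. kernel_integral \<Lambda> h x \<partial>\<mu>)"
    if "h \<in> borel_measurable (borel_on T)" for h
    using assms \<Lambda> that unfolding dlr_measure_def by blast
  have BX: "B \<subseteq> topspace T" using sets.sets_into_space[OF B] by simp
  have sB: "?s ` B \<in> sets (borel_on T)"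
    using measurable_sets[OF swap_measurable[OF \<Lambda> uv] B] swap_image_eq_vimage[OF \<Lambda> uv BX] by simp
  have inj: "?s y \<in> ?s ` B \<longleftrightarrow> y \<in> B" if "y \<in> topspace T" for y
  proof
    assume "?s y \<in> ?s ` B"
    then obtain z where "z \<in> B" "?s y = ?s z" by blast
    then show "y \<in> B" using swap_swap[OF \<Lambda> uv, of z] swap_swap[OF \<Lambda> uv that] BX by auto
  qed simp
  have "emeasure \<mu> (?s ` B) = (\<integral>\<^sup>+x. indicator (?s ` B) x \<partial>\<mu>)" using sB by simp
  \<comment> \<open>The DLR equation moves the problem into a single class, where the swap is a
    permutation of a finite set; its use in reverse at the end returns to \<mu>.\<close>
  also have "\<dots> = (\<integral>\<^sup>+x. kernel_integral \<Lambda> (indicator (?s ` B)) x \<partial>\<mu>)"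
    using sB by (intro dlr) simp
  also have "\<dots> = (\<integral>\<^sup>+x. kernel_integral \<Lambda> (\<lambda>y. ?w y * indicator B y) x \<partial>\<mu>)"
  proof (rule nn_integral_cong)
    fix x assume "x \<in> space \<mu>"
    then have x: "x \<in> topspace T" by simp
    have "kernel_integral \<Lambda> (indicator (?s ` B)) x =
        (\<Sum>y\<in>W \<Lambda> x. ennreal (kern \<Lambda> x (?s y)) * indicator (?s ` B) (?s y))"
      unfolding kernel_integral_def by (rule sum.reindex_bij_betw[OF swap_bij_W[OF \<Lambda> uv x], symmetric])
    also have "\<dots> = kernel_integral \<Lambda> (\<lambda>y. ?w y * indicator B y) x"
      unfolding kernel_integral_def
    proof (rule sum.cong[OF refl])
      fix y assume y: "y \<in> W \<Lambda> x"
      then have yX: "y \<in> topspace T" using W_subset by blast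
      have "?s y \<in> W \<Lambda> x" using swap_in_W[OF \<Lambda> uv yX] W_eq[OF x y] by simp
      \<comment> \<open>The permutation changes the kernel weight by exactly the conformal
        density.\<close>
      then have "kern \<Lambda> x (?s y) = kern \<Lambda> x y * exp (psi y (?s y))"
        using kern_mult_exp[OF \<Lambda> x y] by simp
      then show "ennreal (kern \<Lambda> x (?s y)) * indicator (?s ` B) (?s y) =
          ennreal (kern \<Lambda> x y) * (?w y * indicator B y)"
        using inj[OF yX] by (simp add: ennreal_mult' kern_nonneg indicator_def)
    qed
    finally show "kernel_integral \<Lambda> (indicator (?s ` B)) x =
      kernel_integral \<Lambda> (\<lambda>y. ?w y * indicator B y) x" .
  qed
  also have "\<dots> = (\<integral>\<^sup>+x\<in>B. ?w x \<partial>\<mu>)"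
    using B psi_swap_measurable[OF \<Lambda> uv] by (intro dlr[symmetric]) simp
  finally show "emeasure \<mu> (?s ` B) = (\<integral>\<^sup>+x\<in>B. ?w x \<partial>\<mu>)" .
qed

section \<open>Equivalence of the Gibbs property and the DLR equations\<close>

lemma dlr_imp_gibbs:
  assumes "dlr_measure \<mu>"
  shows "gibbs_measure \<mu>"
  unfolding gibbs_measure_def
proof (intro allI impI, elim conjE)
  fix \<Lambda> \<phi> assume \<Lambda>: "finite \<Lambda>" "\<Lambda> \<subseteq> G" and \<phi>: "continuous_map T euclideanreal \<phi>"
  have "compactin euclideanreal (\<phi> ` topspace T)"
    using compact_T \<phi> unfolding compact_space_def by (rule image_compactin)
  then have "bounded (\<phi> ` topspace T)" by (simp add: compact_imp_bounded)
  then obtain K where K: "\<And>x. x \<in> topspace T \<Longrightarrow> \<bar>\<phi> x\<bar> \<le> K"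
    unfolding bounded_iff by auto
  \<comment> \<open>A continuous function on a compact space is bounded; adding the bound makes it
    nonnegative, so the DLR equation applies. The constant cancels at the end.\<close>
  define \<phi>' where "\<phi>' = (\<lambda>x. \<phi> x + K)"
  have \<phi>m: "\<phi> \<in> borel_measurable (borel_on T)" by (rule continuous_map_borel_measurable[OF \<phi>])
  then have \<phi>'m: "\<phi>' \<in> borel_measurable (borel_on T)" by (simp add: \<phi>'_def)
  have pos: "0 \<le> \<phi>' x" if "x \<in> topspace T" for x using K[OF that] by (simp add: \<phi>'_def)
  have M': "M \<Lambda> \<phi>' x = M \<Lambda> \<phi> x + K" if "x \<in> topspace T" for x
    unfolding \<phi>'_def by (rule M_add_const[OF \<Lambda> that])
  have Mpos: "0 \<le> M \<Lambda> \<phi>' x" for x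
    unfolding M_def using W_subset pos by (intro sum_nonneg mult_nonneg_nonneg kern_nonneg) blast
  have nn: "(\<integral>\<^sup>+x. ennreal (M \<Lambda> \<phi>' x) \<partial>\<mu>) = (\<integral>\<^sup>+x. ennreal (\<phi>' x) \<partial>\<mu>)"
    using assms \<Lambda> \<phi>'m unfolding dlr_measure_def by (simp add: ennreal_M[OF pos])
  have int: "integrable \<mu> \<phi>"
    using \<phi>m K by (intro integrable_const_bound[of _ K]) auto
  then have int': "integrable \<mu> \<phi>'" by (simp add: \<phi>'_def)
  \<comment> \<open>Finiteness of this integral is inherited from \<open>\<phi>'\<close> through the
    DLR equation.\<close>
  have "integrable \<mu> (M \<Lambda> \<phi>')"
  proof (rule integrableI_nonneg)
    show "(\<integral>\<^sup>+x. ennreal (M \<Lambda> \<phi>' x) \<partial>\<mu>) < \<infinity>"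
      unfolding nn using pos int' by (subst nn_integral_eq_integral) auto
  qed (use Mpos M_measurable[OF \<Lambda> \<phi>'m] in auto)
  then have Mint: "integrable \<mu> (M \<Lambda> \<phi>)"
  proof -
    have "integrable \<mu> (\<lambda>x. M \<Lambda> \<phi>' x - K)" using \<open>integrable \<mu> (M \<Lambda> \<phi>')\<close> by simp
    then show ?thesis by (rule Bochner_Integration.integrable_cong[THEN iffD1, rotated 2]) (simp_all add: M')
  qed
  have "integral\<^sup>L \<mu> \<phi>' = integral\<^sup>L \<mu> (M \<Lambda> \<phi>')"
  proof (subst (1 2) integral_eq_nn_integral)
    show "AE x in \<mu>. 0 \<le> \<phi>' x" using pos by (intro AE_I2) simp
  qed (use nn \<phi>'m M_measurable[OF \<Lambda> \<phi>'m] Mpos in auto)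
  also have "\<dots> = (\<integral>x. M \<Lambda> \<phi> x + K \<partial>\<mu>)"
    by (intro Bochner_Integration.integral_cong) (simp_all add: M')
  finally show "integral\<^sup>L \<mu> \<phi> = integral\<^sup>L \<mu> (M \<Lambda> \<phi>)"
    using int Mint by (simp add: \<phi>'_def)
qed

text \<open>The indicator of a clopen set is continuous, hence an admissible test function for the
  Gibbs property.\<close>

lemma gibbs_emeasure_clopen:
  assumes gibbs: "gibbs_measure \<mu>" and \<Lambda>: "finite \<Lambda>" "\<Lambda> \<subseteq> G" and B: "B \<in> clopens"
  shows "emeasure \<mu> B = (\<integral>\<^sup>+x. kernel_integral \<Lambda> (indicator B) x \<partial>\<mu>)"
proof -
  let ?\<phi> = "indicator B :: 'x \<Rightarrow> real"
  have BT: "openin T B" "closedin T B" "B \<in> sets (borel_on T)" "B \<subseteq> topspace T"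
    using B openin_sets openin_subset by (auto simp: clopens_def)
  have "continuous_map T euclideanreal ?\<phi>"
    unfolding continuous_map_def
  proof (intro conjI allI impI)
    fix U :: "real set"
    have "{x \<in> topspace T. ?\<phi> x \<in> U} =
        (if 1 \<in> U then B else {}) \<union> (if 0 \<in> U then topspace T - B else {})"
      using BT(4) by (auto simp: indicator_def split: if_splits)
    then show "openin T {x \<in> topspace T. ?\<phi> x \<in> U}"
      using BT by auto
  qed simp
  then have eq: "integral\<^sup>L \<mu> ?\<phi> = integral\<^sup>L \<mu> (M \<Lambda> ?\<phi>)"
    using gibbs \<Lambda> unfolding gibbs_measure_def by blast
  have Mpos: "0 \<le> M \<Lambda> ?\<phi> x" for x
    unfolding M_def by (intro sum_nonneg mult_nonneg_nonneg kern_nonneg) simp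
  have M1: "M \<Lambda> ?\<phi> x \<le> 1" if "x \<in> topspace T" for x
    unfolding M_def sum_kern[OF \<Lambda> that, symmetric]
    by (intro sum_mono mult_left_le_one_le kern_nonneg) simp_all
  have Mm: "M \<Lambda> ?\<phi> \<in> borel_measurable (borel_on T)"
    using BT(3) by (intro M_measurable[OF \<Lambda>]) simp
  have "integrable \<mu> (M \<Lambda> ?\<phi>)"
    using Mm Mpos M1 by (intro integrable_const_bound[of _ 1]) auto
  then have "(\<integral>\<^sup>+x. ennreal (M \<Lambda> ?\<phi> x) \<partial>\<mu>) = ennreal (integral\<^sup>L \<mu> (M \<Lambda> ?\<phi>))"
    using Mpos by (intro nn_integral_eq_integral) auto
  also have "\<dots> = emeasure \<mu> B"
    unfolding eq[symmetric] using BT(3,4) by (simp add: emeasure_eq_measure Int_absorb2)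
  finally show ?thesis
    using ennreal_M[of ?\<phi> \<Lambda>] by (simp add: ennreal_indicator)
qed

text \<open>The right-hand side of the DLR equation is integration against a measure
  \<open>N\<close>. The Gibbs property shows that \<open>N\<close> and \<mu> agree on the clopen
  sets, so they are equal.\<close>

lemma gibbs_imp_dlr:
  assumes gibbs: "gibbs_measure \<mu>"
  shows "dlr_measure \<mu>"
  unfolding dlr_measure_def
proof (intro allI impI, elim conjE)
  fix \<Lambda> and h :: "'x \<Rightarrow> ennreal" assume \<Lambda>: "finite \<Lambda>" "\<Lambda> \<subseteq> G" and h: "h \<in> borel_measurable (borel_on T)"
  obtain Q where Q: "transversal \<Lambda> Q" using transversal_exists \<Lambda> by blast
  then have QX: "q \<in> Q \<Longrightarrow> q \<in> topspace T" and finQ: "finite Q" for q by (auto simp: transversal_def)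
  \<comment> \<open>\<open>N\<close> is built by choosing a pair of representatives and a point,
    weighting the triple by the transition probability of the corresponding swap, and pushing
    forward along that swap.\<close>
  let ?P = "count_space (Q \<times> Q) \<Otimes>\<^sub>M \<mu>"
  define w :: "('x \<times> 'x) \<times> 'x \<Rightarrow> ennreal" where
    "w = (\<lambda>((q, r), x). indicator (swap_dom \<Lambda> q r) x * ennreal (kern \<Lambda> x (swap \<Lambda> q r x)))"
  define s where "s = (\<lambda>((q, r), x). swap \<Lambda> q r x)"
  have w: "w \<in> borel_measurable ?P"
    using finQ QX swap_dom_sets[OF \<Lambda>] kern_swap_measurable[OF \<Lambda>]
    by (intro measurable_pair_measure_countable1) (auto simp: w_def countable_finite)
  have s: "s \<in> ?P \<rightarrow>\<^sub>M \<mu>"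
    using finQ QX swap_measurable[OF \<Lambda>]
    by (intro measurable_pair_measure_countable1) (auto simp: s_def countable_finite)
  define N where "N = distr (density ?P w) \<mu> s"
  have s': "s \<in> density ?P w \<rightarrow>\<^sub>M \<mu>" using s by (subst measurable_cong_sets[OF sets_density refl])
  have N: "(\<integral>\<^sup>+x. k x \<partial>N) = (\<integral>\<^sup>+x. kernel_integral \<Lambda> k x \<partial>\<mu>)"
    if k: "k \<in> borel_measurable (borel_on T)" for k
  proof -
    have ks: "(\<lambda>z. k (s z)) \<in> borel_measurable ?P"
      using measurable_compose[OF s, of k borel] k by simp
    have "(\<integral>\<^sup>+x. k x \<partial>N) = (\<integral>\<^sup>+z. k (s z) \<partial>density ?P w)"
      unfolding N_def using k by (intro nn_integral_distr s') simp
    also have "\<dots> = (\<integral>\<^sup>+z. w z * k (s z) \<partial>?P)"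
      by (rule nn_integral_density[OF w ks])
    also have "\<dots> = (\<integral>\<^sup>+i. \<integral>\<^sup>+x. w (i, x) * k (s (i, x)) \<partial>\<mu> \<partial>count_space (Q \<times> Q))"
      using w ks by (intro nn_integral_fst[symmetric] borel_measurable_times_ennreal)
    also have "\<dots> = (\<Sum>(q, r)\<in>Q \<times> Q. \<integral>\<^sup>+x. w ((q, r), x) * k (s ((q, r), x)) \<partial>\<mu>)"
      using finQ by (simp add: nn_integral_count_space_finite case_prod_unfold)
    also have "\<dots> = (\<Sum>q\<in>Q. \<Sum>r\<in>Q. \<integral>\<^sup>+x. indicator (swap_dom \<Lambda> q r) x *
          (ennreal (kern \<Lambda> x (swap \<Lambda> q r x)) * k (swap \<Lambda> q r x)) \<partial>\<mu>)"
      by (simp add: sum.cartesian_product w_def s_def mult.assoc)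
    also have "\<dots> = (\<integral>\<^sup>+x. kernel_integral \<Lambda> k x \<partial>\<mu>)"
      unfolding kernel_integral_def
      using kern_swap_measurable[OF \<Lambda>] measurable_compose[OF swap_measurable[OF \<Lambda>] k]
      by (intro nn_integral_sum_W[OF \<Lambda> Q, symmetric] borel_measurable_times_ennreal) auto
    finally show ?thesis .
  qed
  \<comment> \<open>The clopen sets are stable under intersection, generate the Borel sets and
    contain the whole space, so a constant sequence serves as exhaustion of finite measure.\<close>
  have eq: "\<mu> = N"
  proof (rule measure_eqI_generator_eq[where \<Omega> = "topspace T" and E = clopens and A = "\<lambda>_. topspace T"])
    show "Int_stable clopens" by (auto simp: Int_stable_def clopens_def)
    show "clopens \<subseteq> Pow (topspace T)" by (auto simp: clopens_def dest: openin_subset)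
    show "sets \<mu> = sigma_sets (topspace T) clopens" "sets N = sigma_sets (topspace T) clopens"
      by (simp_all add: N_def sets_borel_on_clopens)
    show "range (\<lambda>_ :: nat. topspace T) \<subseteq> clopens" by (auto simp: clopens_def)
    fix B assume B: "B \<in> clopens"
    then have Bs: "B \<in> sets (borel_on T)" using openin_sets by (auto simp: clopens_def)
    have "emeasure N B = (\<integral>\<^sup>+x. indicator B x \<partial>N)" using Bs by (simp add: N_def)
    also have "\<dots> = emeasure \<mu> B"
      using gibbs_emeasure_clopen[OF gibbs \<Lambda> B] N[of "indicator B"] Bs by simp
    finally show "emeasure \<mu> B = emeasure N B" by simp
  qed simp_all
  show "(\<integral>\<^sup>+x. h x \<partial>\<mu>) = (\<integral>\<^sup>+x. kernel_integral \<Lambda> h x \<partial>\<mu>)"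
    using N[OF h, folded eq] .
qed

theorem gibbs_iff_gibbs_conformal: "gibbs_measure \<mu> \<longleftrightarrow> gibbs_conformal_measure \<mu>"
  using gibbs_imp_dlr dlr_imp_gibbs gibbs_conformal_imp_dlr dlr_imp_gibbs_conformal by blast

end

section \<open>Lattice systems and expansive systems\<close>

text \<open>Finite partial sums of the absolute values are bounded by the finite extended sum. This
  turns finiteness of a variation into summability over the reals.\<close>

lemma summable_on_ennreal_abs:
  fixes f :: "'g \<Rightarrow> real"
  assumes "(\<Sum>\<^sub>\<infinity>g\<in>S. ennreal \<bar>f g\<bar>) < \<infinity>"
  shows "f summable_on S"
proof -
  have "sum (\<lambda>g. \<bar>f g\<bar>) E \<le> enn2real (\<Sum>\<^sub>\<infinity>g\<in>S. ennreal \<bar>f g\<bar>)"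
    if "finite E" "E \<subseteq> S" for E
  proof -
    have "ennreal (\<Sum>g\<in>E. \<bar>f g\<bar>) = (\<Sum>g\<in>E. ennreal \<bar>f g\<bar>)"
      by (rule sum_ennreal[symmetric]) simp
    also have "\<dots> \<le> (\<Sum>\<^sub>\<infinity>g\<in>S. ennreal \<bar>f g\<bar>)"
      using that by (subst nonneg_infsum_complete) (auto intro: SUP_upper)
    finally have "enn2real (ennreal (\<Sum>g\<in>E. \<bar>f g\<bar>)) \<le> enn2real (\<Sum>\<^sub>\<infinity>g\<in>S. ennreal \<bar>f g\<bar>)"
      using assms by (intro enn2real_mono) simp_all
    then show ?thesis by (simp add: sum_nonneg)
  qed
  then have "(\<lambda>g. \<bar>f g\<bar>) summable_on S"
    by (intro nonneg_bdd_above_summable_on)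
       (auto intro!: bdd_aboveI2[where M = "enn2real (\<Sum>\<^sub>\<infinity>g\<in>S. ennreal \<bar>f g\<bar>)"])
  then show ?thesis
    by (subst summable_on_iff_abs_summable_on_real) simp
qed

text \<open>The variations control only the sites outside \<Lambda>, while \<open>psi\<close> sums
  over all sites.\<close>

lemma summable_on_if_summable_on_cofinite:
  fixes f :: "'g \<Rightarrow> real"
  assumes "f summable_on (S - E)" "finite E" "E \<subseteq> S"
  shows "f summable_on S"
proof -
  have "f summable_on ((S - E) \<union> E)"
    using assms(1,2) by (intro summable_on_Un_disjoint) auto
  then show ?thesis using assms(3) by (simp add: Un_absorb2)
qed

section \<open>Lattice systems\<close>

lemma (in lattice_system) topspace_lattice_topology: "topspace (lattice_topology G A X) = X"
  using closedin_subset[OF closed_X] by (auto simp: lattice_topology_def)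

lemma (in lattice_system) gibbs_system:
  assumes \<delta>: "0 < \<delta>" "\<delta> < 1" and F: "lattice_potential G A X F"
  shows "gibbs_system G (lattice_topology G A X) lattice_dist \<delta> F"
proof -
  let ?P = "product_topology (\<lambda>g. discrete_topology (A g)) G"
  \<comment> \<open>The distances are 0 or 1, so a threshold strictly between them encodes equality
    of coordinates.\<close>
  have D: "lattice_dist g x y \<le> \<delta> \<longleftrightarrow> x g = y g" for g :: 'g and x y :: "'g \<Rightarrow> 'a"
    using \<delta> by (simp add: lattice_dist_def)
  have XA: "X \<subseteq> Pi\<^sub>E G A" using closedin_subset[OF closed_X] by simp
  \<comment> \<open>A product of finite discrete spaces is compact by Tychonoff's theorem, and
    \<open>X\<close> is closed in it.\<close>
  have compact: "compact_space (lattice_topology G A X)"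
    unfolding lattice_topology_def
    using finite_alphabets closed_X
    by (intro compact_space_subtopology closedin_compact_space)
       (simp_all add: compact_space_product_topology compact_space_discrete_topology)
  have open_D: "openin (lattice_topology G A X) {y \<in> X. x g = y g}" if g: "g \<in> G" and x: "x \<in> X" for g x
  proof -
    have "continuous_map (lattice_topology G A X) (discrete_topology (A g)) (\<lambda>y. y g)"
      unfolding lattice_topology_def
      by (intro continuous_map_from_subtopology continuous_map_product_projection g)
    moreover have "openin (discrete_topology (A g)) {x g}" using XA x g by auto
    ultimately have "openin (lattice_topology G A X) {y \<in> topspace (lattice_topology G A X). y g \<in> {x g}}"
      by (rule openin_continuous_map_preimage)
    then show ?thesis by (simp add: topspace_lattice_topology eq_commute)
  qed
  have summable: "(\<lambda>g. F g y - F g x) summable_on G"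
    if \<Lambda>: "finite \<Lambda>" "\<Lambda> \<subseteq> G" and xy: "x \<in> X" "y \<in> X" "\<And>g. g \<in> G - \<Lambda> \<Longrightarrow> x g = y g" for \<Lambda> x y
  proof (rule summable_on_if_summable_on_cofinite[OF summable_on_ennreal_abs \<Lambda>])
    have "(\<Sum>\<^sub>\<infinity>g\<in>G - \<Lambda>. ennreal \<bar>F g y - F g x\<bar>) \<le> lattice_Delta G X F \<Lambda>"
      unfolding lattice_Delta_def using xy by (intro SUP_upper2[of "(y, x)"]) auto
    also have "\<dots> < \<infinity>" using F \<Lambda> by (simp add: lattice_potential_def)
    finally show "(\<Sum>\<^sub>\<infinity>g\<in>G - \<Lambda>. ennreal \<bar>F g y - F g x\<bar>) < \<infinity>" .
  qed
  show ?thesis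
  proof (unfold_locales, unfold topspace_lattice_topology D)
    fix x y :: "'g \<Rightarrow> 'a"
    show "bdd_above ((\<lambda>g. lattice_dist g x y) ` G)"
      by (rule bdd_aboveI2[of _ _ 1]) (simp add: lattice_dist_def)
  next
    fix g x y show "lattice_dist g x y = lattice_dist g y (x :: 'g \<Rightarrow> 'a)"
      by (simp add: lattice_dist_def eq_commute)
  next
    fix x y assume "x \<in> X" "y \<in> X" "\<And>g. g \<in> G \<Longrightarrow> x g = y g"
    then show "x = y" using XA by (intro PiE_ext[of x G A y]) auto
  next
    fix \<Lambda> x y
    assume "finite \<Lambda>" "\<Lambda> \<subseteq> G" "x \<in> X" "y \<in> X" "\<And>g. g \<in> G - \<Lambda> \<Longrightarrow> x g = y g"
    then show "(\<lambda>g. F g y - F g x) summable_on G" by (rule summable)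
  qed (use countable_sites infinite_sites compact \<delta> open_D F in \<open>simp_all add: lattice_potential_def\<close>)
qed

section \<open>Expansive ultrametric systems\<close>

lemma (in expansive_system) gibbs_system:
  assumes \<epsilon>: "0 < \<epsilon>" "\<epsilon> \<le> c" and f: "f \<in> action_B (carrier \<Gamma>) X act d \<epsilon>"
  shows "gibbs_system (carrier \<Gamma>) metric.mtopology (action_dist act d) \<epsilon> (\<lambda>g x. f (act g x))"
proof -
  have act_cont: "continuous_map metric.mtopology metric.mtopology (act g)" if "g \<in> carrier \<Gamma>" for g
    using homeomorphic[OF that] by (rule homeomorphic_imp_continuous_map)
  have act_X: "act g x \<in> X" if "g \<in> carrier \<Gamma>" "x \<in> X" for g x
    using continuous_map_image_subset_topspace[OF act_cont[OF that(1)]] that(2) by auto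
  have bdd: "bdd_above ((\<lambda>g. action_dist act d g x y) ` carrier \<Gamma>)" if xy: "x \<in> X" "y \<in> X" for x y
  proof -
    have "metric.mbounded X"
      using compact_X metric.compactin_imp_mbounded by (simp add: compact_space_def)
    then obtain B where "\<And>x y. x \<in> X \<Longrightarrow> y \<in> X \<Longrightarrow> d x y \<le> B"
      unfolding metric.mbounded_alt by blast
    then show ?thesis
      using act_X xy by (intro bdd_aboveI2[of _ _ B]) (simp add: action_dist_def)
  qed
  have open_D: "openin metric.mtopology {y \<in> X. action_dist act d g x y \<le> \<epsilon>}"
    if g: "g \<in> carrier \<Gamma>" and x: "x \<in> X" for g x
  proof -
    let ?U = "{z \<in> X. d (act g x) z \<le> \<epsilon>}"
    \<comment> \<open>By the ultrametric inequality a ball of radius \<epsilon> around a point of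
      the closed ball stays inside it, so closed balls of positive radius are open.\<close>
    have "metric.mball z \<epsilon> \<subseteq> ?U" if "z \<in> ?U" for z
    proof
      fix w assume "w \<in> metric.mball z \<epsilon>"
      then have "w \<in> X" "d z w < \<epsilon>" by auto
      then show "w \<in> ?U"
        using ultrametric[of "act g x" z w] that act_X[OF g x] by auto
    qed
    then have "openin metric.mtopology ?U"
      unfolding metric.openin_mtopology using \<epsilon>(1) by blast
    then have "openin metric.mtopology {y \<in> topspace metric.mtopology. act g y \<in> ?U}"
      by (rule openin_continuous_map_preimage[OF act_cont[OF g]])
    moreover have "{y \<in> topspace metric.mtopology. act g y \<in> ?U} = {y \<in> X. action_dist act d g x y \<le> \<epsilon>}"
      using act_X[OF g] by (auto simp: action_dist_def)
    ultimately show ?thesis by simp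
  qed
  have summable: "(\<lambda>g. f (act g y) - f (act g x)) summable_on carrier \<Gamma>"
    if \<Lambda>: "finite \<Lambda>" "\<Lambda> \<subseteq> carrier \<Gamma>" and xy: "x \<in> X" "y \<in> X"
      and near: "\<And>g. g \<in> carrier \<Gamma> - \<Lambda> \<Longrightarrow> action_dist act d g x y \<le> \<epsilon>" for \<Lambda> x y
  proof (rule summable_on_if_summable_on_cofinite[OF summable_on_ennreal_abs \<Lambda>])
    \<comment> \<open>The pointwise bounds pass to the supremum, which makes the pair admissible in
      the variation.\<close>
    have "gibbs_setting.dist_on (action_dist act d) (carrier \<Gamma> - \<Lambda>) x y \<le> \<epsilon>"
      unfolding gibbs_setting.dist_on_def using \<epsilon>(1) near by (auto intro!: cSUP_least)
    then have "(\<Sum>\<^sub>\<infinity>g\<in>carrier \<Gamma> - \<Lambda>. ennreal \<bar>f (act g x) - f (act g y)\<bar>)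
        \<le> action_Delta (carrier \<Gamma>) X act d \<epsilon> f \<Lambda>"
      unfolding action_Delta_def using xy by (intro SUP_upper2[of "(x, y)"]) auto
    also have "\<dots> < \<infinity>" using f \<Lambda> by (simp add: action_B_def)
    finally show "(\<Sum>\<^sub>\<infinity>g\<in>carrier \<Gamma> - \<Lambda>. ennreal \<bar>f (act g y) - f (act g x)\<bar>) < \<infinity>"
      by (simp add: abs_minus_commute)
  qed
  show ?thesis
  proof (unfold_locales, unfold metric.topspace_mtopology)
    fix g x assume "g \<in> carrier \<Gamma>" "x \<in> X"
    then show "action_dist act d g x x \<le> \<epsilon>" using act_X \<epsilon>(1) by (simp add: action_dist_def)
  next
    fix g x y assume "g \<in> carrier \<Gamma>" "x \<in> X" "y \<in> X"
    then show "action_dist act d g x y = action_dist act d g y x"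
      using metric.commute by (simp add: action_dist_def)
  next
    fix g x y z
    assume "g \<in> carrier \<Gamma>" "x \<in> X" "y \<in> X" "z \<in> X"
      "action_dist act d g x y \<le> \<epsilon>" "action_dist act d g y z \<le> \<epsilon>"
    then show "action_dist act d g x z \<le> \<epsilon>"
      using ultrametric[of "act g x" "act g y" "act g z"] act_X by (simp add: action_dist_def)
  next
    fix x y
    assume "x \<in> X" "y \<in> X" "\<And>g. g \<in> carrier \<Gamma> \<Longrightarrow> action_dist act d g x y \<le> \<epsilon>"
    \<comment> \<open>Distinct points are moved more than \<open>c\<close> apart by some group
      element, contradicting closeness at level \<open>\<epsilon> \<le> c\<close>.\<close>
    then show "x = y" using expansive[of x y] \<epsilon>(2) by (force simp: action_dist_def)
  next
    fix g assume "g \<in> carrier \<Gamma>"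
    then show "continuous_map metric.mtopology euclideanreal (\<lambda>x. f (act g x))"
      using continuous_map_compose[OF act_cont, of g euclideanreal f] f
      by (simp add: action_B_def o_def)
  next
    fix \<Lambda> x y
    assume "finite \<Lambda>" "\<Lambda> \<subseteq> carrier \<Gamma>" "x \<in> X" "y \<in> X"
      "\<And>g. g \<in> carrier \<Gamma> - \<Lambda> \<Longrightarrow> action_dist act d g x y \<le> \<epsilon>"
    then show "(\<lambda>g. f (act g y) - f (act g x)) summable_on carrier \<Gamma>" by (rule summable)
  qed (use countable_group infinite_group compact_X \<epsilon> bdd open_D in simp_all)
qed

theorem theorem5p1:
  fixes G :: "'h set" and A :: "'h \<Rightarrow> 'a set" and Y :: "('h \<Rightarrow> 'a) set"
    and F :: "'h \<Rightarrow> ('h \<Rightarrow> 'a) \<Rightarrow> real" and \<nu> :: "('h \<Rightarrow> 'a) measure"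
    and \<Gamma> :: "('g, 'm) monoid_scheme" and X :: "'x set" and act :: "'g \<Rightarrow> 'x \<Rightarrow> 'x"
    and d :: "'x \<Rightarrow> 'x \<Rightarrow> real" and f :: "'x \<Rightarrow> real" and \<mu> :: "'x measure"
    and \<delta> \<epsilon> c :: real
  shows "(lattice_system G A Y \<and> 0 < \<delta> \<and> \<delta> < 1 \<and> lattice_potential G A Y F \<and>
            borel_prob_measure (lattice_topology G A Y) \<nu> \<longrightarrow>
          (gibbs_setting.gibbs_measure G (lattice_topology G A Y) lattice_dist \<delta> F \<nu> \<longleftrightarrow>
           gibbs_setting.gibbs_conformal_measure G (lattice_topology G A Y) lattice_dist \<delta> F \<nu>))
       \<and> (expansive_system \<Gamma> X act d c \<and> 0 < \<epsilon> \<and> \<epsilon> \<le> c \<and>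
            f \<in> action_B (carrier \<Gamma>) X act d \<epsilon> \<and>
            borel_prob_measure (Metric_space.mtopology X d) \<mu> \<longrightarrow>
          (gibbs_setting.gibbs_measure (carrier \<Gamma>) (Metric_space.mtopology X d)
             (action_dist act d) \<epsilon> (\<lambda>g x. f (act g x)) \<mu> \<longleftrightarrow>
           gibbs_setting.gibbs_conformal_measure (carrier \<Gamma>) (Metric_space.mtopology X d)
             (action_dist act d) \<epsilon> (\<lambda>g x. f (act g x)) \<mu>))"
proof (intro conjI impI; elim conjE)
  assume L: "lattice_system G A Y" "0 < \<delta>" "\<delta> < 1" "lattice_potential G A Y F"
    and \<nu>: "borel_prob_measure (lattice_topology G A Y) \<nu>"
  from lattice_system.gibbs_system[OF L]
  have "gibbs_system_measure G (lattice_topology G A Y) lattice_dist \<delta> F \<nu>"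
    by (intro gibbs_system_measure.intro gibbs_system_measure_axioms.intro \<nu>)
  then show "gibbs_setting.gibbs_measure G (lattice_topology G A Y) lattice_dist \<delta> F \<nu> \<longleftrightarrow>
      gibbs_setting.gibbs_conformal_measure G (lattice_topology G A Y) lattice_dist \<delta> F \<nu>"
    by (rule gibbs_system_measure.gibbs_iff_gibbs_conformal)
next
  assume E: "expansive_system \<Gamma> X act d c" "0 < \<epsilon>" "\<epsilon> \<le> c" "f \<in> action_B (carrier \<Gamma>) X act d \<epsilon>"
    and \<mu>: "borel_prob_measure (Metric_space.mtopology X d) \<mu>"
  from expansive_system.gibbs_system[OF E]
  have "gibbs_system_measure (carrier \<Gamma>) (Metric_space.mtopology X d)
      (action_dist act d) \<epsilon> (\<lambda>g x. f (act g x)) \<mu>"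
    by (intro gibbs_system_measure.intro gibbs_system_measure_axioms.intro \<mu>)
  then show "gibbs_setting.gibbs_measure (carrier \<Gamma>) (Metric_space.mtopology X d)
        (action_dist act d) \<epsilon> (\<lambda>g x. f (act g x)) \<mu> \<longleftrightarrow>
      gibbs_setting.gibbs_conformal_measure (carrier \<Gamma>) (Metric_space.mtopology X d)
        (action_dist act d) \<epsilon> (\<lambda>g x. f (act g x)) \<mu>"
    by (rule gibbs_system_measure.gibbs_iff_gibbs_conformal)
qed

end
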